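(* Let $k,l$ be positive integers and let $M$ be a matroid with Tutte polynomial $T_M(x,y)=\sum_{i,j\ge 0}t_{i,j}x^iy^j$. Then $M$ is almost $(k,l)$-uniform if and only if $t_{k,l}\le 1$ and $t_{i,j}=0$ for every pair $(i,j)>(k,l)$.
   Context: For pairs of integers, $(i,j)>(k,l)$ means $i\ge k$, $j\ge l$ and $(i,j)\neq(k,l)$. For positive integers $k,l$, a matroid is $(k,l)$-uniform if it has no minor isomorphic to $U_{k,k}\oplus U_{0,l}$ ($k$ coloops and $l$ loops). A matroid $M$ is almost $(k,l)$-uniform if for every element $v$ of its ground set, at least one of $M-v$ (deletion) or $M/v$ (contraction) is $(k,l)$-uniform. The Tutte polynomial is $T_M(x,y)=\sum_B x^{\mathrm{int}(B)}y^{\mathrm{ext}(B)}$ over all bases $B$, where, for a fixed total order on the ground set $E$, $\mathrm{int}(B)$ counts $v\in B$ which are the smallest element of the unique cocircuit contained in $(E-B)\cup\{v\}$ and $\mathrm{ext}(B)$ counts $v\notin B$ which are the smallest element of the unique circuit contained in $B\cup\{v\}$; it is independent of the order. *)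

theory Defs
  imports Main "HOL-Computational_Algebra.Polynomial"
begin

record 'a matroid =
  ground :: "'a set"
  indep :: "'a set set"

locale matroid =
  fixes M :: "'a matroid"
  assumes finite_ground: "finite (ground M)"
    and indep_subset_ground: "I \<in> indep M \<Longrightarrow> I \<subseteq> ground M"
    and empty_indep: "{} \<in> indep M"
    and indep_subset: "I \<in> indep M \<Longrightarrow> J \<subseteq> I \<Longrightarrow> J \<in> indep M"
    and augmentation: "I \<in> indep M \<Longrightarrow> J \<in> indep M \<Longrightarrow> card I < card J \<Longrightarrow>
      \<exists>x\<in>J - I. insert x I \<in> indep M"

definition bases :: "'a matroid \<Rightarrow> 'a set set" where
  "bases M = {B \<in> indep M. \<forall>I\<in>indep M. B \<subseteq> I \<longrightarrow> I = B}"

definition circuits :: "'a matroid \<Rightarrow> 'a set set" where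
  "circuits M = {C. C \<subseteq> ground M \<and> C \<notin> indep M \<and> (\<forall>D. D \<subset> C \<longrightarrow> D \<in> indep M)}"

(* The bases of the dual are the complements of the bases of M. *)
definition dual :: "'a matroid \<Rightarrow> 'a matroid" where
  "dual M = \<lparr>ground = ground M,
             indep = {I. I \<subseteq> ground M \<and> (\<exists>B\<in>bases M. I \<subseteq> ground M - B)}\<rparr>"

definition cocircuits :: "'a matroid \<Rightarrow> 'a set set" where
  "cocircuits M = circuits (dual M)"

definition delete :: "'a matroid \<Rightarrow> 'a set \<Rightarrow> 'a matroid" where
  "delete M X = \<lparr>ground = ground M - X, indep = {I \<in> indep M. I \<subseteq> ground M - X}\<rparr>"

definition contract :: "'a matroid \<Rightarrow> 'a set \<Rightarrow> 'a matroid" where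
  "contract M X = dual (delete (dual M) X)"

definition is_minor :: "'a matroid \<Rightarrow> 'a matroid \<Rightarrow> bool" where
  "is_minor N M \<longleftrightarrow> (\<exists>X Y. X \<subseteq> ground M \<and> Y \<subseteq> ground M \<and> X \<inter> Y = {} \<and>
     N = delete (contract M X) Y)"

definition isomorphic :: "'a matroid \<Rightarrow> 'b matroid \<Rightarrow> bool" where
  "isomorphic M N \<longleftrightarrow> (\<exists>f. bij_betw f (ground M) (ground N) \<and>
     (\<forall>I. I \<subseteq> ground M \<longrightarrow> (I \<in> indep M \<longleftrightarrow> f ` I \<in> indep N)))"

(* U_{r,n}: rank r on n elements. *)
definition uniform_matroid :: "nat \<Rightarrow> nat \<Rightarrow> nat matroid" where
  "uniform_matroid r n = \<lparr>ground = {..<n}, indep = {I. I \<subseteq> {..<n} \<and> card I \<le> r}\<rparr>"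

definition direct_sum :: "'a matroid \<Rightarrow> 'b matroid \<Rightarrow> ('a + 'b) matroid" where
  "direct_sum M N = \<lparr>ground = ground M <+> ground N,
                     indep = {I <+> J |I J. I \<in> indep M \<and> J \<in> indep N}\<rparr>"

definition kl_uniform :: "nat \<Rightarrow> nat \<Rightarrow> 'a matroid \<Rightarrow> bool" where
  "kl_uniform k l M \<longleftrightarrow> \<not> (\<exists>N. is_minor N M \<and>
     isomorphic N (direct_sum (uniform_matroid k k) (uniform_matroid 0 l)))"

definition almost_kl_uniform :: "nat \<Rightarrow> nat \<Rightarrow> 'a matroid \<Rightarrow> bool" where
  "almost_kl_uniform k l M \<longleftrightarrow>
     (\<forall>v\<in>ground M. kl_uniform k l (delete M {v}) \<or> kl_uniform k l (contract M {v}))"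

definition fundamental_circuit :: "'a matroid \<Rightarrow> 'a set \<Rightarrow> 'a \<Rightarrow> 'a set" where
  "fundamental_circuit M B v = (THE C. C \<in> circuits M \<and> C \<subseteq> insert v B)"

definition fundamental_cocircuit :: "'a matroid \<Rightarrow> 'a set \<Rightarrow> 'a \<Rightarrow> 'a set" where
  "fundamental_cocircuit M B v =
     (THE C. C \<in> cocircuits M \<and> C \<subseteq> insert v (ground M - B))"

(* Orders are reflexive relations: (x, y) \<in> r means x is at most y. *)
definition smallest_in :: "('a \<times> 'a) set \<Rightarrow> 'a set \<Rightarrow> 'a \<Rightarrow> bool" where
  "smallest_in r S v \<longleftrightarrow> v \<in> S \<and> (\<forall>u\<in>S. (v, u) \<in> r)"

definition internal_activity :: "('a \<times> 'a) set \<Rightarrow> 'a matroid \<Rightarrow> 'a set \<Rightarrow> nat" where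
  "internal_activity r M B = card {v \<in> B. smallest_in r (fundamental_cocircuit M B v) v}"

definition external_activity :: "('a \<times> 'a) set \<Rightarrow> 'a matroid \<Rightarrow> 'a set \<Rightarrow> nat" where
  "external_activity r M B =
     card {v \<in> ground M - B. smallest_in r (fundamental_circuit M B v) v}"

(* Z[x, y] is represented as (Z[y])[x]: the outer variable is x and the inner one is y,
   so monom (monom c j) i is c * x^i * y^j.  The order r on the ground set is an
   explicit argument; the polynomial does not depend on it when r is a total order. *)
definition tutte_poly :: "('a \<times> 'a) set \<Rightarrow> 'a matroid \<Rightarrow> int poly poly" where
  "tutte_poly r M =
     (\<Sum>B\<in>bases M. monom (monom 1 (external_activity r M B)) (internal_activity r M B))"

definition tutte_coeff :: "('a \<times> 'a) set \<Rightarrow> 'a matroid \<Rightarrow> nat \<Rightarrow> nat \<Rightarrow> int" where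
  "tutte_coeff r M i j = coeff (coeff (tutte_poly r M) i) j"

definition pair_gt :: "nat \<times> nat \<Rightarrow> nat \<times> nat \<Rightarrow> bool" where
  "pair_gt p q \<longleftrightarrow> fst p \<ge> fst q \<and> snd p \<ge> snd q \<and> p \<noteq> q"

end

(* Both the sum over bases and the corank-nullity sum of (x - 1)^(r(E) - r(A)) (y - 1)^(|A| - r(A))
   obey the deletion-contraction rules: the former when the removed element is the greatest in the
   order, the latter for every element. Hence they agree, and T_M = T_(M - v) + T_(M / v) for
   every v that is neither a loop nor a coloop. As the coefficients are nonnegative, M is
   (k, l)-uniform iff t_(i,j) = 0 for all i >= k and j >= l. If the coefficient condition holds for M,
   then M - v and M / v cannot both contribute to these coefficients, so one of them is uniform.
   Conversely, being almost (k, l)-uniform passes to minors, so if M / v, say, is uniform, then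
   M and M - v have the same coefficients in the range i >= k, j >= l and induction applies; it ends
   with a matroid of i coloops and j loops, whose Tutte polynomial is x^i y^j. *)
theory Submission imports Defs
begin

section \<open>Rank functions\<close>

text \<open>Two expressions for the Tutte polynomial are kept because each fails where the other
  works. Activities can be followed only when the greatest element is removed: dropping it from a
  circuit or cocircuit cannot change whether another member is the smallest. But almost uniformity
  concerns an arbitrary \<open>v\<close>, so a recursion at every element is required; the
  corank-nullity sum has one because it mentions no order.

  The definition of contraction passes through two duals and is awkward to iterate. The argument
  therefore runs on pairs of a ground set and a rank function: deletion only shrinks the ground set,
  contraction changes the function by an explicit formula, and \<open>rank_matroid\<close> links
  both to the defined operations.

  The final matroid of i coloops and j loops cannot have (i,j) > (k,l): a spare coloop or loop could
  be removed, deletion and contraction of it coincide, and both would still have the forbidden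
  minor.\<close>

locale rank_function =
  fixes E :: "'a set" and \<rho> :: "'a set \<Rightarrow> nat"
  assumes fin: "finite E"
    and rank_le_card: "A \<subseteq> E \<Longrightarrow> \<rho> A \<le> card A"
    and rank_mono: "A \<subseteq> B \<Longrightarrow> B \<subseteq> E \<Longrightarrow> \<rho> A \<le> \<rho> B"
    and rank_submodular: "A \<subseteq> E \<Longrightarrow> B \<subseteq> E \<Longrightarrow> \<rho> (A \<union> B) + \<rho> (A \<inter> B) \<le> \<rho> A + \<rho> B"

definition contract_rank :: "'a set \<Rightarrow> ('a set \<Rightarrow> nat) \<Rightarrow> 'a set \<Rightarrow> nat" where
  "contract_rank X \<rho> A = \<rho> (A \<union> X) - \<rho> X"

text \<open>On subsets of \<open>E\<close> the sum is at least \<open>\<rho> E\<close> (see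
  \<open>rank_ground_le\<close>), so with the terms in this order the subtraction on
  \<open>nat\<close> never truncates.\<close>

definition dual_rank :: "'a set \<Rightarrow> ('a set \<Rightarrow> nat) \<Rightarrow> 'a set \<Rightarrow> nat" where
  "dual_rank E \<rho> A = card A + \<rho> (E - A) - \<rho> E"

definition rank_bases :: "'a set \<Rightarrow> ('a set \<Rightarrow> nat) \<Rightarrow> 'a set set" where
  "rank_bases E \<rho> = {B. B \<subseteq> E \<and> \<rho> B = card B \<and> \<rho> B = \<rho> E}"

definition rank_matroid :: "'a set \<Rightarrow> ('a set \<Rightarrow> nat) \<Rightarrow> 'a matroid" where
  "rank_matroid E \<rho> = \<lparr>ground = E, indep = {I. I \<subseteq> E \<and> \<rho> I = card I}\<rparr>"

lemma ground_rank_matroid [simp]: "ground (rank_matroid E \<rho>) = E"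
  by (simp add: rank_matroid_def)

lemma indep_rank_matroid: "I \<in> indep (rank_matroid E \<rho>) \<longleftrightarrow> I \<subseteq> E \<and> \<rho> I = card I"
  by (simp add: rank_matroid_def)

lemma rank_matroid_cong:
  "(\<And>A. A \<subseteq> E \<Longrightarrow> \<rho> A = \<sigma> A) \<Longrightarrow> rank_matroid E \<rho> = rank_matroid E \<sigma>"
  by (auto simp: rank_matroid_def)

context rank_function
begin

lemma rank_empty [simp]: "\<rho> {} = 0"
  using rank_le_card[of "{}"] by simp

lemma finite_subset_ground: "A \<subseteq> E \<Longrightarrow> finite A"
  using fin finite_subset by blast

lemma rank_Un_le: "A \<subseteq> E \<Longrightarrow> B \<subseteq> E \<Longrightarrow> \<rho> (A \<union> B) \<le> \<rho> A + \<rho> B"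
  using rank_submodular[of A B] by linarith

lemma rank_le_diff:
  assumes "A \<subseteq> B" "B \<subseteq> E"
  shows "\<rho> B \<le> \<rho> A + card (B - A)"
proof -
  have "B = A \<union> (B - A)" using assms by blast
  then have "\<rho> B \<le> \<rho> A + \<rho> (B - A)"
    using rank_Un_le[of A "B - A"] assms by auto
  also have "\<rho> (B - A) \<le> card (B - A)" using assms by (intro rank_le_card) auto
  finally show ?thesis by simp
qed

lemma rank_insert_le: "A \<subseteq> E \<Longrightarrow> v \<in> E \<Longrightarrow> \<rho> (insert v A) \<le> \<rho> A + \<rho> {v}"
  using rank_Un_le[of A "{v}"] by simp

text \<open>Diminishing returns: submodularity is applied to \<open>B\<close> and
  \<open>A \<union> Z\<close>, whose union is \<open>B \<union> Z\<close> and whose intersection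
  contains \<open>A\<close>.\<close>

lemma rank_diminishing:
  assumes "A \<subseteq> B" "B \<subseteq> E" "Z \<subseteq> E"
  shows "\<rho> (B \<union> Z) + \<rho> A \<le> \<rho> B + \<rho> (A \<union> Z)"
proof -
  have "\<rho> (B \<union> (A \<union> Z)) + \<rho> (B \<inter> (A \<union> Z)) \<le> \<rho> B + \<rho> (A \<union> Z)"
    using assms by (intro rank_submodular) auto
  moreover have "\<rho> A \<le> \<rho> (B \<inter> (A \<union> Z))" using assms by (intro rank_mono) auto
  moreover have "B \<union> (A \<union> Z) = B \<union> Z" using assms by auto
  ultimately show ?thesis by simp
qed

text \<open>Adding the elements of \<open>Z\<close> one at a time, diminishing returns bounds each
  gain by the gain over \<open>A\<close> itself, which is zero.\<close>

lemma rank_closure: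
  assumes "A \<subseteq> E" "Z \<subseteq> E" "\<And>x. x \<in> Z \<Longrightarrow> \<rho> (insert x A) = \<rho> A"
  shows "\<rho> (A \<union> Z) = \<rho> A"
proof -
  have "finite Z" using assms finite_subset_ground by blast
  then show ?thesis using assms(2,3)
  proof (induction Z)
    case (insert x Z)
    have "\<rho> ((A \<union> Z) \<union> {x}) + \<rho> A \<le> \<rho> (A \<union> Z) + \<rho> (A \<union> {x})"
      using insert assms by (intro rank_diminishing) auto
    then have "\<rho> (A \<union> insert x Z) \<le> \<rho> A" using insert by simp
    moreover have "\<rho> A \<le> \<rho> (A \<union> insert x Z)" using insert assms by (intro rank_mono) auto
    ultimately show ?case by simp
  qed simp
qed

lemma indep_subset_rank:
  assumes "\<rho> I = card I" "I \<subseteq> E" "J \<subseteq> I"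
  shows "\<rho> J = card J"
proof -
  have "\<rho> I \<le> \<rho> J + card (I - J)" using assms rank_le_diff by blast
  moreover have "card (I - J) = card I - card J" "card J \<le> card I"
    using assms finite_subset_ground by (auto simp: card_Diff_subset card_mono finite_subset)
  moreover have "\<rho> J \<le> card J" using assms rank_le_card by auto
  ultimately show ?thesis using assms by linarith
qed

text \<open>Greedy extension: as long as some element of \<open>Z\<close> raises the rank, it is
  added and independence is kept. When none does, \<open>rank_closure\<close> shows that the full
  rank of \<open>Z\<close> has been reached.\<close>

lemma extend_indep:
  assumes "\<rho> I = card I" "I \<subseteq> Z" "Z \<subseteq> E"
  obtains B where "I \<subseteq> B" "B \<subseteq> Z" "\<rho> B = card B" "\<rho> B = \<rho> Z"
proof -
  have "\<exists>B. I \<subseteq> B \<and> B \<subseteq> Z \<and> \<rho> B = card B \<and> \<rho> B = \<rho> Z"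
    using assms(1,2)
  proof (induction "card Z - card I" arbitrary: I rule: less_induct)
    case less
    show ?case
    proof (cases "\<forall>x\<in>Z. \<rho> (insert x I) = \<rho> I")
      case True
      then have "\<rho> (I \<union> Z) = \<rho> I" using less.prems assms by (intro rank_closure) auto
      moreover have "I \<union> Z = Z" using less.prems by auto
      ultimately show ?thesis using less.prems by auto
    next
      case False
      then obtain x where x: "x \<in> Z" "\<rho> (insert x I) \<noteq> \<rho> I" by blast
      then have xI: "x \<notin> I" by (auto simp: insert_absorb)
      have finI: "finite I" using less.prems assms finite_subset_ground by blast
      have "\<rho> I \<le> \<rho> (insert x I)" using less.prems assms x by (intro rank_mono) auto
      then have "\<rho> (insert x I) \<ge> card (insert x I)" using x less.prems xI finI by simp
      then have ind: "\<rho> (insert x I) = card (insert x I)"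
        using rank_le_card[of "insert x I"] x less.prems assms by auto
      have "card (insert x I) \<le> card Z"
        using x less.prems assms finite_subset_ground by (intro card_mono) auto
      then have "card Z - card (insert x I) < card Z - card I" using xI finI by simp
      moreover have "insert x I \<subseteq> Z" using x(1) less.prems(2) by simp
      ultimately obtain B where "insert x I \<subseteq> B" "B \<subseteq> Z" "\<rho> B = card B" "\<rho> B = \<rho> Z"
        using less.hyps[OF _ ind] by blast
      then show ?thesis by (intro exI[of _ B]) simp
    qed
  qed
  then show ?thesis using that by blast
qed

lemma bases_rank_matroid: "bases (rank_matroid E \<rho>) = rank_bases E \<rho>"
proof (intro set_eqI iffI)
  fix B assume B: "B \<in> bases (rank_matroid E \<rho>)"
  then have B1: "B \<subseteq> E" "\<rho> B = card B" by (auto simp: bases_def indep_rank_matroid)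
  obtain B' where "B \<subseteq> B'" "B' \<subseteq> E" "\<rho> B' = card B'" "\<rho> B' = \<rho> E"
    using extend_indep[of B E] B1 by auto
  moreover then have "B' = B" using B by (auto simp: bases_def indep_rank_matroid)
  ultimately show "B \<in> rank_bases E \<rho>" by (auto simp: rank_bases_def)
next
  fix B assume B: "B \<in> rank_bases E \<rho>"
  { fix I assume I: "I \<subseteq> E" "\<rho> I = card I" "B \<subseteq> I"
    have "card I \<le> card B" using rank_mono[of I E] I B by (auto simp: rank_bases_def)
    then have "I = B" using I finite_subset_ground by (metis card_seteq) }
  then show "B \<in> bases (rank_matroid E \<rho>)" using B
    by (auto simp: bases_def indep_rank_matroid rank_bases_def)
qed

lemma finite_rank_bases: "finite (rank_bases E \<rho>)"
  by (rule finite_subset[of _ "Pow E"]) (auto simp: rank_bases_def fin)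

section \<open>Deletion, duality and contraction of rank functions\<close>

lemma restrict: "F \<subseteq> E \<Longrightarrow> rank_function F \<rho>"
  by unfold_locales
    (use finite_subset_ground rank_mono rank_submodular rank_le_card in \<open>meson subset_trans\<close>)+

lemma rank_ground_le: "A \<subseteq> E \<Longrightarrow> \<rho> E \<le> card A + \<rho> (E - A)"
  using rank_le_diff[of "E - A" E] by (simp add: double_diff)

lemma dual: "rank_function E (dual_rank E \<rho>)"
proof
  show "finite E" by (rule fin)
  show "dual_rank E \<rho> A \<le> card A" if "A \<subseteq> E" for A
    using rank_mono[of "E - A" E] by (simp add: dual_rank_def)
  show "dual_rank E \<rho> A \<le> dual_rank E \<rho> B" if "A \<subseteq> B" "B \<subseteq> E" for A B
  proof -
    have "\<rho> (E - A) \<le> \<rho> (E - B) + card ((E - A) - (E - B))"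
      using that by (intro rank_le_diff) auto
    moreover have "(E - A) - (E - B) = B - A" using that by auto
    moreover have "card (B - A) = card B - card A" "card A \<le> card B"
      using that finite_subset_ground by (auto simp: card_Diff_subset card_mono finite_subset)
    ultimately show ?thesis by (auto simp: dual_rank_def)
  qed
  show "dual_rank E \<rho> (A \<union> B) + dual_rank E \<rho> (A \<inter> B) \<le> dual_rank E \<rho> A + dual_rank E \<rho> B"
    if AB: "A \<subseteq> E" "B \<subseteq> E" for A B
  proof -
    have "\<rho> ((E - A) \<union> (E - B)) + \<rho> ((E - A) \<inter> (E - B)) \<le> \<rho> (E - A) + \<rho> (E - B)"
      by (intro rank_submodular) auto
    moreover have "(E - A) \<union> (E - B) = E - (A \<inter> B)" "(E - A) \<inter> (E - B) = E - (A \<union> B)"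
      by auto
    moreover have "card A + card B = card (A \<union> B) + card (A \<inter> B)"
      using AB finite_subset_ground by (intro card_Un_Int) auto
    \<comment> \<open>These bounds exclude truncation in all four dual ranks, so that the submodular
      inequality for the complements can be combined with the count of elements.\<close>
    moreover have "\<rho> E \<le> card A + \<rho> (E - A)" "\<rho> E \<le> card B + \<rho> (E - B)"
      "\<rho> E \<le> card (A \<union> B) + \<rho> (E - (A \<union> B))" "\<rho> E \<le> card (A \<inter> B) + \<rho> (E - (A \<inter> B))"
      using AB by (auto intro!: rank_ground_le)
    ultimately show ?thesis by (simp add: dual_rank_def)
  qed
qed

lemma contract:
  assumes X: "X \<subseteq> E"
  shows "rank_function (E - X) (contract_rank X \<rho>)"
proof
  show "finite (E - X)" using fin by simp
  have le: "\<rho> X \<le> \<rho> (A \<union> X)" if "A \<subseteq> E" for A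
    using that X by (intro rank_mono) auto
  show "contract_rank X \<rho> A \<le> card A" if "A \<subseteq> E - X" for A
  proof -
    have "\<rho> (A \<union> X) \<le> \<rho> A + \<rho> X" using that X by (intro rank_Un_le) auto
    moreover have "\<rho> A \<le> card A" using that by (intro rank_le_card) auto
    ultimately show ?thesis by (simp add: contract_rank_def)
  qed
  show "contract_rank X \<rho> A \<le> contract_rank X \<rho> B" if "A \<subseteq> B" "B \<subseteq> E - X" for A B
    using that X unfolding contract_rank_def by (intro diff_le_mono rank_mono) auto
  show "contract_rank X \<rho> (A \<union> B) + contract_rank X \<rho> (A \<inter> B)
      \<le> contract_rank X \<rho> A + contract_rank X \<rho> B"
    if AB: "A \<subseteq> E - X" "B \<subseteq> E - X" for A B
  proof -
    have "\<rho> ((A \<union> X) \<union> (B \<union> X)) + \<rho> ((A \<union> X) \<inter> (B \<union> X)) \<le> \<rho> (A \<union> X) + \<rho> (B \<union> X)"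
      using AB X by (intro rank_submodular) auto
    moreover have "(A \<union> X) \<union> (B \<union> X) = (A \<union> B) \<union> X" "(A \<union> X) \<inter> (B \<union> X) = (A \<inter> B) \<union> X"
      by auto
    moreover have "\<rho> X \<le> \<rho> (A \<union> X)" "\<rho> X \<le> \<rho> (B \<union> X)" "\<rho> X \<le> \<rho> ((A \<union> B) \<union> X)"
      "\<rho> X \<le> \<rho> ((A \<inter> B) \<union> X)"
      using AB by (auto intro!: le)
    ultimately show ?thesis by (simp add: contract_rank_def)
  qed
qed

lemma rank_bases_dual:
  assumes "A \<subseteq> E"
  shows "A \<in> rank_bases E (dual_rank E \<rho>) \<longleftrightarrow> E - A \<in> rank_bases E \<rho>"
proof -
  have "card (E - A) = card E - card A" "card A \<le> card E"
    using assms finite_subset_ground fin by (auto simp: card_Diff_subset card_mono)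
  moreover have "\<rho> E \<le> card A + \<rho> (E - A)" using assms by (rule rank_ground_le)
  moreover have "\<rho> E \<le> card E" "\<rho> (E - A) \<le> card (E - A)" "\<rho> (E - A) \<le> \<rho> E"
    by (auto intro: rank_le_card rank_mono)
  moreover have "dual_rank E \<rho> E = card E - \<rho> E" by (simp add: dual_rank_def)
  ultimately have "dual_rank E \<rho> A = card A \<and> dual_rank E \<rho> A = dual_rank E \<rho> E \<longleftrightarrow>
      \<rho> (E - A) = card (E - A) \<and> \<rho> (E - A) = \<rho> E"
    unfolding dual_rank_def by linarith
  then show ?thesis using assms by (auto simp: rank_bases_def)
qed

text \<open>A set avoids some basis exactly when its complement still has full rank, and this is
  what \<open>dual_rank E \<rho> I = card I\<close> says.\<close>

lemma dual_rank_matroid: "dual (rank_matroid E \<rho>) = rank_matroid E (dual_rank E \<rho>)"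
proof -
  have "(\<exists>B\<in>rank_bases E \<rho>. I \<subseteq> E - B) \<longleftrightarrow> dual_rank E \<rho> I = card I" if I: "I \<subseteq> E" for I
  proof
    assume "\<exists>B\<in>rank_bases E \<rho>. I \<subseteq> E - B"
    then obtain B where B: "B \<in> rank_bases E \<rho>" "I \<subseteq> E - B" by blast
    then have "\<rho> B \<le> \<rho> (E - I)" by (intro rank_mono) (auto simp: rank_bases_def)
    moreover have "\<rho> (E - I) \<le> \<rho> E" by (intro rank_mono) auto
    ultimately show "dual_rank E \<rho> I = card I" using B by (auto simp: rank_bases_def dual_rank_def)
  next
    assume *: "dual_rank E \<rho> I = card I"
    have "\<rho> (E - I) \<le> \<rho> E" by (intro rank_mono) auto
    then have "\<rho> (E - I) = \<rho> E" using * rank_ground_le[OF I] by (simp add: dual_rank_def)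
    moreover obtain B where "B \<subseteq> E - I" "\<rho> B = card B" "\<rho> B = \<rho> (E - I)"
      using extend_indep[of "{}" "E - I"] by auto
    ultimately show "\<exists>B\<in>rank_bases E \<rho>. I \<subseteq> E - B"
      using I by (intro bexI[of _ B]) (auto simp: rank_bases_def)
  qed
  then have "{I. I \<subseteq> E \<and> (\<exists>B\<in>rank_bases E \<rho>. I \<subseteq> E - B)} = {I. I \<subseteq> E \<and> dual_rank E \<rho> I = card I}"
    by blast
  then show ?thesis
    unfolding Defs.dual_def bases_rank_matroid ground_rank_matroid by (simp add: rank_matroid_def)
qed

lemma delete_rank_matroid: "delete (rank_matroid E \<rho>) X = rank_matroid (E - X) \<rho>"
  by (auto simp: delete_def rank_matroid_def)

text \<open>Taking the dual rank, restricting to \<open>E - X\<close> and taking the dual rank again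
  makes the cardinalities and the terms \<open>\<rho> E\<close> cancel; what remains is the rank
  gained over \<open>X\<close>.\<close>

lemma contract_rank_matroid:
  assumes X: "X \<subseteq> E"
  shows "Defs.contract (rank_matroid E \<rho>) X = rank_matroid (E - X) (contract_rank X \<rho>)"
proof -
  interpret D: rank_function E "dual_rank E \<rho>" by (rule dual)
  interpret DX: rank_function "E - X" "dual_rank E \<rho>" by (rule D.restrict) auto
  have "dual_rank (E - X) (dual_rank E \<rho>) A = contract_rank X \<rho> A" if A: "A \<subseteq> E - X" for A
  proof -
    have eq: "E - (E - X - A) = A \<union> X" "E - (E - X) = X" using A X by auto
    have "card (E - X) = card A + card (E - X - A)"
      using A fin by (metis card_Diff_subset card_mono finite_Diff le_add_diff_inverse finite_subset)
    moreover have "\<rho> E \<le> card (E - X - A) + \<rho> (A \<union> X)" "\<rho> E \<le> card (E - X) + \<rho> X"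
      using rank_ground_le[of "E - X - A"] rank_ground_le[of "E - X"] eq by auto
    ultimately show ?thesis by (simp add: dual_rank_def contract_rank_def eq)
  qed
  then have "rank_matroid (E - X) (dual_rank (E - X) (dual_rank E \<rho>)) =
      rank_matroid (E - X) (contract_rank X \<rho>)"
    by (rule rank_matroid_cong)
  then show ?thesis
    by (simp add: Defs.contract_def dual_rank_matroid D.delete_rank_matroid DX.dual_rank_matroid)
qed

section \<open>Fundamental circuits and cocircuits through basis exchange\<close>

lemma rank_basis_exchange_size:
  assumes "B \<in> rank_bases E \<rho>" "B' \<subseteq> E" "card B' = card B" "\<rho> B' = card B'"
  shows "B' \<in> rank_bases E \<rho>"
  using assms by (auto simp: rank_bases_def)

text \<open>Every circuit inside \<open>insert v B\<close> is shown to equal the set of exchangeable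
  elements, which gives the uniqueness behind \<open>THE\<close> without circuit elimination.
  Activities thereby become statements about bases alone, and bases are easy to follow through
  minors.\<close>

lemma fundamental_circuit_rank_matroid:
  assumes B: "B \<in> rank_bases E \<rho>" and v: "v \<in> E - B"
  shows "fundamental_circuit (rank_matroid E \<rho>) B v =
    {u \<in> insert v B. insert v B - {u} \<in> rank_bases E \<rho>}" (is "_ = ?C")
proof -
  let ?V = "insert v B"
  have V: "?V \<subseteq> E" and finB: "finite B" using B v finite_subset_ground by (auto simp: rank_bases_def)
  have dep: "\<rho> ?V \<noteq> card ?V"
  proof -
    have "\<rho> ?V \<le> card B" using rank_mono[of ?V E] V B by (auto simp: rank_bases_def)
    then show ?thesis using v finB by auto
  qed
  have eq: "C = ?C" if C: "C \<in> circuits (rank_matroid E \<rho>)" "C \<subseteq> ?V" for C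
  proof
    have Cdep: "\<rho> C \<noteq> card C" and CE: "C \<subseteq> E" using C V by (auto simp: circuits_def indep_rank_matroid)
    show "?C \<subseteq> C"
    proof
      fix u assume u: "u \<in> ?C"
      show "u \<in> C"
      proof (rule ccontr)
        assume "u \<notin> C"
        then have "C \<subseteq> ?V - {u}" using C by auto
        then show False using u Cdep V indep_subset_rank[of "?V - {u}" C] by (auto simp: rank_bases_def)
      qed
    qed
    show "C \<subseteq> ?C"
    proof
      fix u assume u: "u \<in> C"
      then have "C - {u} \<subset> C" by auto
      then have "\<rho> (C - {u}) = card (C - {u})" using C by (auto simp: circuits_def indep_rank_matroid)
      \<comment> \<open>The extension \<open>D\<close> has as many elements as \<open>B\<close>, one
        fewer than \<open>insert v B\<close>, and it misses \<open>u\<close> because it cannot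
        contain the dependent set \<open>C\<close>. So it is
        \<open>insert v B - {u}\<close>.\<close>
      then obtain D where D: "C - {u} \<subseteq> D" "D \<subseteq> ?V" "\<rho> D = card D" "\<rho> D = \<rho> ?V"
        using extend_indep[of "C - {u}" ?V] C V by auto
      have "\<rho> B \<le> \<rho> ?V" "\<rho> ?V \<le> \<rho> E" using V by (auto intro: rank_mono)
      then have DB: "card D = card B" using D B by (auto simp: rank_bases_def)
      have "u \<notin> D"
      proof
        assume "u \<in> D"
        then have "C \<subseteq> D" using D by auto
        then show False using D V Cdep indep_subset_rank[of D C] by auto
      qed
      then have "D \<subseteq> ?V - {u}" using D by auto
      moreover have "card (?V - {u}) = card B" using u C finB v by (auto simp: card_Diff_singleton)
      ultimately have "D = ?V - {u}" using DB finB by (intro card_seteq) auto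
      then show "u \<in> ?C" using u C D DB B V rank_basis_exchange_size[of B D] by auto
    qed
  qed
  have "\<exists>C. C \<subseteq> ?V \<and> \<rho> C \<noteq> card C" using dep by auto
  \<comment> \<open>Existence: a dependent subset of least cardinality has only independent proper
    subsets, hence is a circuit.\<close>
  then obtain C where C: "C \<subseteq> ?V" "\<rho> C \<noteq> card C"
    and min: "\<And>D. D \<subseteq> ?V \<Longrightarrow> \<rho> D \<noteq> card D \<Longrightarrow> card C \<le> card D"
    using ex_has_least_nat[of "\<lambda>C. C \<subseteq> ?V \<and> \<rho> C \<noteq> card C" _ card] by metis
  have "\<rho> D = card D" if "D \<subset> C" for D
    using min[of D] that C finB psubset_card_mono[of C D] finite_subset[of C ?V] by auto
  then have "C \<in> circuits (rank_matroid E \<rho>)"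
    using C V by (auto simp: circuits_def indep_rank_matroid)
  then show ?thesis unfolding fundamental_circuit_def
    using eq C by (intro the_equality) auto
qed

text \<open>The circuit description applied to the dual and the basis \<open>E - B\<close>;
  complementing turns removal of \<open>u\<close> from \<open>insert v (E - B)\<close> into
  insertion of \<open>u\<close> into \<open>B - {v}\<close>.\<close>

lemma fundamental_cocircuit_rank_matroid:
  assumes B: "B \<in> rank_bases E \<rho>" and v: "v \<in> B"
  shows "fundamental_cocircuit (rank_matroid E \<rho>) B v =
    {u \<in> insert v (E - B). insert u (B - {v}) \<in> rank_bases E \<rho>}"
proof -
  interpret D: rank_function E "dual_rank E \<rho>" by (rule dual)
  have BE: "B \<subseteq> E" using B by (auto simp: rank_bases_def)
  then have "E - B \<in> rank_bases E (dual_rank E \<rho>)"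
    using B by (simp add: rank_bases_dual double_diff)
  moreover have "fundamental_cocircuit (rank_matroid E \<rho>) B v =
      fundamental_circuit (rank_matroid E (dual_rank E \<rho>)) (E - B) v"
    by (simp add: fundamental_cocircuit_def fundamental_circuit_def cocircuits_def dual_rank_matroid)
  ultimately have "fundamental_cocircuit (rank_matroid E \<rho>) B v =
      {u \<in> insert v (E - B). insert v (E - B) - {u} \<in> rank_bases E (dual_rank E \<rho>)}"
    using D.fundamental_circuit_rank_matroid[of "E - B" v] v BE by auto
  moreover have "insert v (E - B) - {u} \<in> rank_bases E (dual_rank E \<rho>) \<longleftrightarrow>
      insert u (B - {v}) \<in> rank_bases E \<rho>" if "u \<in> insert v (E - B)" for u
  proof -
    have "E - (insert v (E - B) - {u}) = insert u (B - {v})" using that v BE by auto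
    moreover have "insert v (E - B) - {u} \<subseteq> E" using v BE by auto
    ultimately show ?thesis by (simp add: rank_bases_dual)
  qed
  ultimately show ?thesis by auto
qed

end

section \<open>Deletion and contraction for the Tutte polynomial\<close>

abbreviation poly_x :: "int poly poly" where "poly_x \<equiv> [:0, 1:]"
abbreviation poly_y :: "int poly poly" where "poly_y \<equiv> [:[:0, 1:]:]"

text \<open>Whitney's corank-nullity form of the Tutte polynomial. Monotonicity and
  \<open>rank_le_card\<close> make both exponents exact differences for a rank function.\<close>

definition rank_poly :: "'a set \<Rightarrow> ('a set \<Rightarrow> nat) \<Rightarrow> int poly poly" where
  "rank_poly E \<rho> =
     (\<Sum>A\<in>Pow E. (poly_x - 1) ^ (\<rho> E - \<rho> A) * (poly_y - 1) ^ (card A - \<rho> A))"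

lemma rank_poly_cong:
  "(\<And>A. A \<subseteq> E \<Longrightarrow> \<rho> A = \<sigma> A) \<Longrightarrow> rank_poly E \<rho> = rank_poly E \<sigma>"
  unfolding rank_poly_def by (intro sum.cong) auto

context rank_function
begin

lemma rank_singleton: "v \<in> E \<Longrightarrow> \<rho> {v} = 0 \<or> \<rho> {v} = 1"
  using rank_le_card[of "{v}"] by auto

lemma rank_delete:
  assumes "v \<in> E"
  shows "\<rho> (E - {v}) \<le> \<rho> E" "\<rho> E \<le> \<rho> (E - {v}) + \<rho> {v}"
  using assms rank_mono[of "E - {v}" E] rank_insert_le[of "E - {v}" v] by (auto simp: insert_absorb)

lemma contract_rank_loop:
  assumes "v \<in> E" "\<rho> {v} = 0" "A \<subseteq> E"
  shows "contract_rank {v} \<rho> A = \<rho> A"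
  using assms rank_insert_le[of A v] rank_mono[OF subset_insertI, of v A]
  by (auto simp: contract_rank_def)

text \<open>By diminishing returns \<open>v\<close> gains at least as much over \<open>A\<close> as
  over \<open>E - {v}\<close>, hence exactly one. So deletion and contraction of a coloop give the
  same rank function, as they do for a loop.\<close>

lemma contract_rank_coloop:
  assumes "v \<in> E" "\<rho> (E - {v}) < \<rho> E" "A \<subseteq> E - {v}"
  shows "contract_rank {v} \<rho> A = \<rho> A"
proof -
  have "\<rho> ((E - {v}) \<union> {v}) + \<rho> A \<le> \<rho> (E - {v}) + \<rho> (A \<union> {v})"
    using assms by (intro rank_diminishing) auto
  moreover have "(E - {v}) \<union> {v} = E" using assms by auto
  moreover have "\<rho> (A \<union> {v}) \<le> \<rho> A + \<rho> {v}" using assms by (intro rank_Un_le) auto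
  ultimately show ?thesis
    using assms rank_delete[of v] rank_singleton[of v] by (auto simp: contract_rank_def)
qed

text \<open>The subsets avoiding \<open>v\<close> give the deletion and those containing
  \<open>v\<close> the contraction. Removing a coloop lowers the corank of every set avoiding it by
  one, and removing a loop lowers the nullity of every set containing it by one; this is the origin
  of the factors. When both minors coincide, (x - 1) + 1 or (y - 1) + 1 is left as the
  factor.\<close>

lemma rank_poly_split:
  assumes v: "v \<in> E"
  shows "rank_poly E \<rho> =
    (if \<rho> (E - {v}) < \<rho> E then poly_x - 1 else 1) * rank_poly (E - {v}) \<rho> +
    (if \<rho> {v} = 0 then poly_y - 1 else 1) * rank_poly (E - {v}) (contract_rank {v} \<rho>)"
proof -
  let ?F = "E - {v}"
  let ?t = "\<lambda>A. (poly_x - 1) ^ (\<rho> E - \<rho> A) * (poly_y - 1) ^ (card A - \<rho> A)"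
  have E: "E = insert v ?F" using v by auto
  have Pow: "Pow E = Pow ?F \<union> insert v ` Pow ?F"
    using Pow_insert[of v ?F] v by (simp add: insert_absorb)
  have "inj_on (insert v) (Pow ?F)" by (auto simp: inj_on_def)
  then have "(\<Sum>A\<in>Pow E. ?t A) = (\<Sum>A\<in>Pow ?F. ?t A) + (\<Sum>A\<in>Pow ?F. ?t (insert v A))"
    unfolding Pow using fin by (subst sum.union_disjoint) (auto simp: sum.reindex)
  moreover have "?t A = (if \<rho> ?F < \<rho> E then poly_x - 1 else 1) *
      ((poly_x - 1) ^ (\<rho> ?F - \<rho> A) * (poly_y - 1) ^ (card A - \<rho> A))" if A: "A \<in> Pow ?F" for A
  proof -
    have "\<rho> A \<le> \<rho> ?F" using A by (intro rank_mono) auto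
    moreover have "\<rho> E = (if \<rho> ?F < \<rho> E then Suc (\<rho> ?F) else \<rho> ?F)"
      using rank_delete[OF v] rank_singleton[OF v] by auto
    ultimately have "\<rho> E - \<rho> A = (if \<rho> ?F < \<rho> E then Suc (\<rho> ?F - \<rho> A) else \<rho> ?F - \<rho> A)" by auto
    then show ?thesis by (simp add: mult.assoc)
  qed
  moreover have "?t (insert v A) = (if \<rho> {v} = 0 then poly_y - 1 else 1) *
      ((poly_x - 1) ^ (contract_rank {v} \<rho> ?F - contract_rank {v} \<rho> A) *
       (poly_y - 1) ^ (card A - contract_rank {v} \<rho> A))" if A: "A \<in> Pow ?F" for A
  proof -
    have le: "\<rho> {v} \<le> \<rho> (insert v A)" "\<rho> (insert v A) \<le> \<rho> E"
      using A v by (auto intro: rank_mono)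
    have "contract_rank {v} \<rho> ?F - contract_rank {v} \<rho> A = \<rho> E - \<rho> (insert v A)"
      using le v by (simp add: contract_rank_def insert_absorb)
    moreover have "card (insert v A) = Suc (card A)"
      using A fin by (subst card_insert_disjoint) (auto intro: finite_subset)
    \<comment> \<open>This bounds the contracted rank of \<open>A\<close> by \<open>card A\<close>,
      so that in the loop case \<open>Suc\<close> may be moved out of the subtraction.\<close>
    moreover have "\<rho> (insert v A) \<le> \<rho> {v} + card A"
      using rank_insert_le[of A v] rank_le_card[of A] subset_trans[of A _ E] A v by fastforce
    ultimately have "card (insert v A) - \<rho> (insert v A) =
        (if \<rho> {v} = 0 then Suc (card A - contract_rank {v} \<rho> A) else card A - contract_rank {v} \<rho> A)"
      using le rank_singleton[OF v] by (auto simp: contract_rank_def)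
    then show ?thesis
      using \<open>contract_rank {v} \<rho> ?F - contract_rank {v} \<rho> A = \<rho> E - \<rho> (insert v A)\<close>
      by (simp add: mult.assoc mult.left_commute)
  qed
  ultimately show ?thesis unfolding rank_poly_def by (simp add: sum_distrib_left)
qed

lemma rank_poly_loop:
  assumes v: "v \<in> E" "\<rho> {v} = 0"
  shows "rank_poly E \<rho> = poly_y * rank_poly (E - {v}) \<rho>"
proof -
  have "rank_poly (E - {v}) (contract_rank {v} \<rho>) = rank_poly (E - {v}) \<rho>"
    using v by (intro rank_poly_cong contract_rank_loop) auto
  moreover have "\<not> \<rho> (E - {v}) < \<rho> E" using rank_delete[OF v(1)] v by auto
  ultimately show ?thesis using rank_poly_split[OF v(1)] v by (simp add: algebra_simps)
qed

lemma rank_poly_coloop: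
  assumes v: "v \<in> E" "\<rho> (E - {v}) < \<rho> E"
  shows "rank_poly E \<rho> = poly_x * rank_poly (E - {v}) \<rho>"
proof -
  have "rank_poly (E - {v}) (contract_rank {v} \<rho>) = rank_poly (E - {v}) \<rho>"
    using v by (intro rank_poly_cong contract_rank_coloop) auto
  moreover have "\<rho> {v} \<noteq> 0" using rank_delete[OF v(1)] v by auto
  ultimately show ?thesis using rank_poly_split[OF v(1)] v by (simp add: algebra_simps)
qed

lemma rank_poly_delete_contract:
  assumes "v \<in> E" "\<rho> {v} \<noteq> 0" "\<rho> (E - {v}) = \<rho> E"
  shows "rank_poly E \<rho> = rank_poly (E - {v}) \<rho> + rank_poly (E - {v}) (contract_rank {v} \<rho>)"
  using rank_poly_split[OF assms(1)] assms by simp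

section \<open>Bases of the minors, and loops and coloops seen from a basis\<close>

lemma rank_bases_delete:
  assumes "\<rho> (E - {e}) = \<rho> E" "B \<subseteq> E - {e}"
  shows "B \<in> rank_bases (E - {e}) \<rho> \<longleftrightarrow> B \<in> rank_bases E \<rho>"
  using assms by (auto simp: rank_bases_def)

lemma rank_bases_contract:
  assumes e: "e \<in> E" "\<rho> {e} \<noteq> 0" and B: "B \<subseteq> E - {e}"
  shows "B \<in> rank_bases (E - {e}) (contract_rank {e} \<rho>) \<longleftrightarrow> insert e B \<in> rank_bases E \<rho>"
proof -
  have "\<rho> {e} = 1" using rank_singleton[of e] e by auto
  moreover have "\<rho> {e} \<le> \<rho> (insert e B)" "\<rho> {e} \<le> \<rho> E" using e B by (auto intro!: rank_mono)
  moreover have "card (insert e B) = Suc (card B)"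
    using B fin by (subst card_insert_disjoint) (auto intro: finite_subset)
  ultimately show ?thesis using e B by (auto simp: rank_bases_def contract_rank_def insert_absorb)
qed

lemma not_loop_of_basis:
  assumes "B \<in> rank_bases E \<rho>" "e \<in> B"
  shows "\<rho> {e} \<noteq> 0"
  using assms indep_subset_rank[of B "{e}"] by (auto simp: rank_bases_def)

lemma not_coloop_of_basis:
  assumes "B \<in> rank_bases E \<rho>" "e \<notin> B"
  shows "\<rho> (E - {e}) = \<rho> E"
proof -
  have "B \<subseteq> E - {e}" using assms by (auto simp: rank_bases_def)
  then have "\<rho> B \<le> \<rho> (E - {e})" "\<rho> (E - {e}) \<le> \<rho> E" by (simp_all add: rank_mono)
  then show ?thesis using assms by (auto simp: rank_bases_def)
qed

text \<open>This decides when the fundamental circuit of \<open>e\<close> is just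
  \<open>{e}\<close>. If \<open>e\<close> is not a loop, \<open>{e}\<close> extends to a basis
  inside \<open>insert e B\<close>, and by cardinality this basis omits exactly one \<open>u\<close>
  of \<open>B\<close>.\<close>

lemma loop_iff_exchange:
  assumes B: "B \<in> rank_bases E \<rho>" and e: "e \<in> E - B"
  shows "\<rho> {e} = 0 \<longleftrightarrow> (\<forall>u\<in>B. insert e B - {u} \<notin> rank_bases E \<rho>)"
proof
  assume "\<rho> {e} = 0"
  then show "\<forall>u\<in>B. insert e B - {u} \<notin> rank_bases E \<rho>"
    using not_loop_of_basis e by blast
next
  assume *: "\<forall>u\<in>B. insert e B - {u} \<notin> rank_bases E \<rho>"
  have BE: "B \<subseteq> E" "finite B" using B finite_subset_ground by (auto simp: rank_bases_def)
  show "\<rho> {e} = 0"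
  proof (rule ccontr)
    assume "\<rho> {e} \<noteq> 0"
    then have "\<rho> {e} = card {e}" using rank_singleton[of e] e by auto
    then obtain D where D: "{e} \<subseteq> D" "D \<subseteq> insert e B" "\<rho> D = card D" "\<rho> D = \<rho> (insert e B)"
      using extend_indep[of "{e}" "insert e B"] BE e by auto
    have "\<rho> B \<le> \<rho> (insert e B)" "\<rho> (insert e B) \<le> \<rho> E"
      using BE e by (auto intro: rank_mono)
    then have cD: "card D = card B" using D B by (auto simp: rank_bases_def)
    then have "D \<noteq> insert e B" using e BE by auto
    then obtain u where u: "u \<in> insert e B" "u \<notin> D" using D by auto
    then have uB: "u \<in> B" using D by auto
    have "D \<subseteq> insert e B - {u}" using D u by auto
    moreover have "card (insert e B - {u}) = card B" using u e BE by (simp add: card_Diff_singleton)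
    ultimately have "D = insert e B - {u}" using cD BE by (intro card_seteq) auto
    then have "insert e B - {u} \<in> rank_bases E \<rho>"
      using rank_basis_exchange_size[OF B, of D] D cD BE e by auto
    then show False using * uB by auto
  qed
qed

text \<open>The counterpart for the fundamental cocircuit of \<open>e\<close>. If deleting
  \<open>e\<close> keeps the rank, then \<open>B\<close> extends inside \<open>E - {e}\<close> to a
  basis, which has exactly one further element.\<close>

lemma coloop_iff_exchange:
  assumes B: "insert e B \<in> rank_bases E \<rho>" and e: "e \<notin> B"
  shows "\<rho> (E - {e}) < \<rho> E \<longleftrightarrow> (\<forall>u\<in>E - insert e B. insert u B \<notin> rank_bases E \<rho>)"
proof
  assume "\<rho> (E - {e}) < \<rho> E"
  then show "\<forall>u\<in>E - insert e B. insert u B \<notin> rank_bases E \<rho>"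
    using not_coloop_of_basis[of "insert u B" e for u] e by fastforce
next
  assume *: "\<forall>u\<in>E - insert e B. insert u B \<notin> rank_bases E \<rho>"
  have BE: "insert e B \<subseteq> E" "finite B" using B finite_subset_ground by (auto simp: rank_bases_def)
  show "\<rho> (E - {e}) < \<rho> E"
  proof (rule ccontr)
    assume "\<not> \<rho> (E - {e}) < \<rho> E"
    then have eq: "\<rho> (E - {e}) = \<rho> E" using rank_delete[of e] BE by auto
    have "\<rho> B = card B" using indep_subset_rank[of "insert e B" B] B by (auto simp: rank_bases_def)
    then obtain D where D: "B \<subseteq> D" "D \<subseteq> E - {e}" "\<rho> D = card D" "\<rho> D = \<rho> (E - {e})"
      using extend_indep[of B "E - {e}"] BE e by auto
    have finD: "finite D" using D by (intro finite_subset_ground) auto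
    have cD: "card D = Suc (card B)" using D eq B BE e by (auto simp: rank_bases_def)
    then have "D \<noteq> B" by auto
    then obtain u where u: "u \<in> D" "u \<notin> B" using D by auto
    have "insert u B = D" using u D cD BE finD by (intro card_seteq) auto
    moreover have "D \<in> rank_bases E \<rho>" using D eq by (auto simp: rank_bases_def)
    ultimately show False using * u D by auto
  qed
qed

end

text \<open>Unlike \<open>linear_order_on\<close>, this does not confine \<open>r\<close> to \<open>E\<close>, so it passes to subsets.\<close>

definition linear_order_among :: "('a \<times> 'a) set \<Rightarrow> 'a set \<Rightarrow> bool" where
  "linear_order_among r E \<longleftrightarrow> refl_on E r \<and> antisym r \<and> trans r \<and> total_on E r"

lemma linear_order_among_subset:
  "linear_order_among r E \<Longrightarrow> F \<subseteq> E \<Longrightarrow> linear_order_among r F"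
  by (auto simp: linear_order_among_def refl_on_def total_on_def)

lemma greatest_exists:
  assumes "finite E" "E \<noteq> {}" "linear_order_among r E"
  shows "\<exists>e\<in>E. \<forall>x\<in>E. (x, e) \<in> r"
  using assms
proof (induction E rule: finite_ne_induct)
  case (singleton x)
  then show ?case by (auto simp: linear_order_among_def refl_on_def)
next
  case (insert x F)
  then obtain e where e: "e \<in> F" "\<forall>y\<in>F. (y, e) \<in> r"
    using linear_order_among_subset[of r "insert x F" F] by auto
  have "(x, x) \<in> r" "(x, e) \<in> r \<or> (e, x) \<in> r" "trans r"
    using insert.prems insert.hyps e by (auto simp: linear_order_among_def refl_on_def total_on_def)
  moreover have "\<forall>y\<in>insert x F. (y, x) \<in> r" if "(e, x) \<in> r"
    using that e \<open>(x, x) \<in> r\<close> transD[OF \<open>trans r\<close>, of _ e x] by blast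
  ultimately show ?case using e by blast
qed

lemma smallest_in_remove_greatest:
  assumes "(v, e) \<in> r" "v \<noteq> e"
  shows "smallest_in r S v \<longleftrightarrow> smallest_in r (S - {e}) v"
  using assms by (auto simp: smallest_in_def)

lemma smallest_in_greatest:
  assumes "linear_order_among r E" "\<forall>x\<in>E. (x, e) \<in> r" "e \<in> E" "S \<subseteq> E"
  shows "smallest_in r S e \<longleftrightarrow> S = {e}"
proof
  assume S: "smallest_in r S e"
  have "u = e" if "u \<in> S" for u
    using S that assms(1,2,4) by (auto simp: smallest_in_def linear_order_among_def intro: antisymD)
  then show "S = {e}" using S by (auto simp: smallest_in_def)
next
  assume "S = {e}"
  then show "smallest_in r S e" using assms(2,3) by (simp add: smallest_in_def)
qed

section \<open>Activities under removal of the greatest element\<close>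

context rank_function
begin

context
  fixes r e
  assumes r: "linear_order_among r E" and e: "e \<in> E" and greatest: "\<forall>x\<in>E. (x, e) \<in> r"
begin

text \<open>Since \<open>e\<close> is not in \<open>B\<close>, the fundamental circuits of the other
  elements avoid \<open>e\<close> and stay the same, while the cocircuits can only lose
  \<open>e\<close>, which never affects a smaller element. The greatest element itself is active
  only if its circuit is \<open>{e}\<close>, that is, if it is a loop.\<close>

lemma activities_delete:
  assumes B: "B \<in> rank_bases E \<rho>" and eB: "e \<notin> B"
  shows "internal_activity r (rank_matroid E \<rho>) B =
           internal_activity r (rank_matroid (E - {e}) \<rho>) B" (is ?int)
    and "external_activity r (rank_matroid E \<rho>) B =
           external_activity r (rank_matroid (E - {e}) \<rho>) B + (if \<rho> {e} = 0 then 1 else 0)" (is ?ext)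
proof -
  interpret F: rank_function "E - {e}" \<rho> by (rule restrict) auto
  have BE: "B \<subseteq> E - {e}" using B eB by (auto simp: rank_bases_def)
  have nc: "\<rho> (E - {e}) = \<rho> E" using not_coloop_of_basis[OF B eB] .
  have BF: "B \<in> rank_bases (E - {e}) \<rho>" using B BE nc by (simp add: rank_bases_delete)
  have cocirc: "fundamental_cocircuit (rank_matroid E \<rho>) B v - {e} =
      fundamental_cocircuit (rank_matroid (E - {e}) \<rho>) B v" if v: "v \<in> B" for v
  proof -
    have "insert u (B - {v}) \<in> rank_bases (E - {e}) \<rho> \<longleftrightarrow> insert u (B - {v}) \<in> rank_bases E \<rho>"
      if "u \<in> E - {e}" for u
      using that BE nc by (intro rank_bases_delete) auto
    then show ?thesis using v BE
      by (auto simp: fundamental_cocircuit_rank_matroid[OF B v] F.fundamental_cocircuit_rank_matroid[OF BF v])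
  qed
  have "smallest_in r (fundamental_cocircuit (rank_matroid E \<rho>) B v) v =
      smallest_in r (fundamental_cocircuit (rank_matroid (E - {e}) \<rho>) B v) v" if v: "v \<in> B" for v
    unfolding cocirc[OF v, symmetric]
    using v BE greatest by (intro smallest_in_remove_greatest) auto
  then have "{v \<in> B. smallest_in r (fundamental_cocircuit (rank_matroid E \<rho>) B v) v} =
      {v \<in> B. smallest_in r (fundamental_cocircuit (rank_matroid (E - {e}) \<rho>) B v) v}"
    by blast
  then show ?int by (simp add: internal_activity_def)
  have circ: "smallest_in r (fundamental_circuit (rank_matroid E \<rho>) B v) v =
      smallest_in r (fundamental_circuit (rank_matroid (E - {e}) \<rho>) B v) v" if v: "v \<in> E - {e} - B" for v
  proof -
    have v': "v \<in> E - B" using v by auto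
    have "insert v B - {u} \<in> rank_bases (E - {e}) \<rho> \<longleftrightarrow> insert v B - {u} \<in> rank_bases E \<rho>" for u
      using v BE nc by (intro rank_bases_delete) auto
    then show ?thesis
      by (simp add: fundamental_circuit_rank_matroid[OF B v'] F.fundamental_circuit_rank_matroid[OF BF v])
  qed
  have "fundamental_circuit (rank_matroid E \<rho>) B e \<subseteq> E"
    using fundamental_circuit_rank_matroid[OF B] e eB BE by auto
  then have "smallest_in r (fundamental_circuit (rank_matroid E \<rho>) B e) e \<longleftrightarrow>
      fundamental_circuit (rank_matroid E \<rho>) B e = {e}"
    using smallest_in_greatest[OF r greatest e] by blast
  also have "\<dots> \<longleftrightarrow> \<rho> {e} = 0"
    using loop_iff_exchange[OF B, of e] fundamental_circuit_rank_matroid[OF B, of e] e eB B by auto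
  finally have "{v \<in> E - B. smallest_in r (fundamental_circuit (rank_matroid E \<rho>) B v) v} =
      {v \<in> E - {e} - B. smallest_in r (fundamental_circuit (rank_matroid (E - {e}) \<rho>) B v) v} \<union>
      (if \<rho> {e} = 0 then {e} else {})"
    using circ e eB by auto
  then show ?ext using fin by (simp add: external_activity_def)
qed

text \<open>The roles of \<open>activities_delete\<close> are exchanged: with \<open>e\<close> in
  the basis, the cocircuits of the other elements avoid \<open>e\<close>, the circuits can only lose
  it, and \<open>e\<close> itself is active exactly when it is a coloop.\<close>

lemma activities_contract:
  assumes B: "insert e B \<in> rank_bases E \<rho>" and eB: "e \<notin> B"
  shows "internal_activity r (rank_matroid E \<rho>) (insert e B) =
           internal_activity r (rank_matroid (E - {e}) (contract_rank {e} \<rho>)) B +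
           (if \<rho> (E - {e}) < \<rho> E then 1 else 0)" (is ?int)
    and "external_activity r (rank_matroid E \<rho>) (insert e B) =
           external_activity r (rank_matroid (E - {e}) (contract_rank {e} \<rho>)) B" (is ?ext)
proof -
  let ?\<sigma> = "contract_rank {e} \<rho>"
  interpret F: rank_function "E - {e}" ?\<sigma> using e by (intro contract) auto
  have BE: "B \<subseteq> E - {e}" using B eB by (auto simp: rank_bases_def)
  then have finB: "finite B" by (rule F.finite_subset_ground)
  have nl: "\<rho> {e} \<noteq> 0" using not_loop_of_basis[OF B] by auto
  have BF: "B \<in> rank_bases (E - {e}) ?\<sigma>" using B BE nl e by (simp add: rank_bases_contract)
  have circ: "fundamental_circuit (rank_matroid E \<rho>) (insert e B) v - {e} =
      fundamental_circuit (rank_matroid (E - {e}) ?\<sigma>) B v" if v: "v \<in> E - {e} - B" for v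
  proof -
    have v': "v \<in> E - insert e B" using v by auto
    have "insert v B - {u} \<in> rank_bases (E - {e}) ?\<sigma> \<longleftrightarrow> insert v (insert e B) - {u} \<in> rank_bases E \<rho>"
      if "u \<in> insert v B" for u
    proof -
      have "insert v (insert e B) - {u} = insert e (insert v B - {u})" using that v eB by auto
      then show ?thesis using rank_bases_contract[OF e nl, of "insert v B - {u}"] v BE by auto
    qed
    moreover have "{u \<in> insert v (insert e B). P u} - {e} = {u \<in> insert v B. Q u}"
      if "\<And>u. u \<in> insert v B \<Longrightarrow> Q u = P u" for P Q
      using v eB that by blast
    ultimately show ?thesis
      unfolding fundamental_circuit_rank_matroid[OF B v'] F.fundamental_circuit_rank_matroid[OF BF v]
      by presburger
  qed
  have "smallest_in r (fundamental_circuit (rank_matroid E \<rho>) (insert e B) v) v =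
      smallest_in r (fundamental_circuit (rank_matroid (E - {e}) ?\<sigma>) B v) v"
    if v: "v \<in> E - {e} - B" for v
    unfolding circ[OF v, symmetric]
    using v greatest by (intro smallest_in_remove_greatest) auto
  moreover have "E - insert e B = E - {e} - B" by auto
  ultimately have "{v \<in> E - insert e B.
        smallest_in r (fundamental_circuit (rank_matroid E \<rho>) (insert e B) v) v} =
      {v \<in> E - {e} - B. smallest_in r (fundamental_circuit (rank_matroid (E - {e}) ?\<sigma>) B v) v}"
    by blast
  then show ?ext by (simp add: external_activity_def)
  have cocirc: "smallest_in r (fundamental_cocircuit (rank_matroid E \<rho>) (insert e B) v) v =
      smallest_in r (fundamental_cocircuit (rank_matroid (E - {e}) ?\<sigma>) B v) v" if v: "v \<in> B" for v
  proof -
    have v': "v \<in> insert e B" using v by auto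
    have "insert u (B - {v}) \<in> rank_bases (E - {e}) ?\<sigma> \<longleftrightarrow> insert u (insert e B - {v}) \<in> rank_bases E \<rho>"
      if "u \<in> insert v (E - insert e B)" for u
    proof -
      have "insert u (insert e B - {v}) = insert e (insert u (B - {v}))" using v eB by auto
      then show ?thesis using rank_bases_contract[OF e nl, of "insert u (B - {v})"] that v BE by auto
    qed
    moreover have "E - {e} - B = E - insert e B" by auto
    ultimately show ?thesis
      by (simp add: fundamental_cocircuit_rank_matroid[OF B v']
          F.fundamental_cocircuit_rank_matroid[OF BF v] cong: conj_cong)
  qed
  have "fundamental_cocircuit (rank_matroid E \<rho>) (insert e B) e \<subseteq> E"
    using fundamental_cocircuit_rank_matroid[OF B, of e] e by auto
  then have "smallest_in r (fundamental_cocircuit (rank_matroid E \<rho>) (insert e B) e) e \<longleftrightarrow>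
      fundamental_cocircuit (rank_matroid E \<rho>) (insert e B) e = {e}"
    using smallest_in_greatest[OF r greatest e] by blast
  also have "\<dots> \<longleftrightarrow> \<rho> (E - {e}) < \<rho> E"
    using coloop_iff_exchange[OF B eB] fundamental_cocircuit_rank_matroid[OF B, of e] eB B by auto
  finally have "{v \<in> insert e B. smallest_in r (fundamental_cocircuit (rank_matroid E \<rho>) (insert e B) v) v} =
      {v \<in> B. smallest_in r (fundamental_cocircuit (rank_matroid (E - {e}) ?\<sigma>) B v) v} \<union>
      (if \<rho> (E - {e}) < \<rho> E then {e} else {})"
    using cocirc by auto
  then show ?int using finB eB by (simp add: internal_activity_def)
qed

text \<open>Bases avoiding \<open>e\<close> are bases of the deletion, and bases containing
  \<open>e\<close> correspond to bases of the contraction. A coloop lies in every basis and a loop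
  in none, hence the zeros; the factors y and x record the activity of \<open>e\<close>
  itself.\<close>

lemma tutte_poly_split:
  "tutte_poly r (rank_matroid E \<rho>) =
    (if \<rho> (E - {e}) < \<rho> E then 0
     else (if \<rho> {e} = 0 then poly_y else 1) * tutte_poly r (rank_matroid (E - {e}) \<rho>)) +
    (if \<rho> {e} = 0 then 0
     else (if \<rho> (E - {e}) < \<rho> E then poly_x else 1) *
       tutte_poly r (rank_matroid (E - {e}) (contract_rank {e} \<rho>)))"
proof -
  let ?m = "\<lambda>E \<rho> B. monom (monom 1 (external_activity r (rank_matroid E \<rho>) B))
    (internal_activity r (rank_matroid E \<rho>) B) :: int poly poly"
  let ?\<sigma> = "contract_rank {e} \<rho>" and ?F = "E - {e}"
  interpret D: rank_function ?F \<rho> by (rule restrict) auto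
  interpret C: rank_function ?F ?\<sigma> using e by (intro contract) auto
  have xm: "poly_x * monom (monom 1 j) i = monom (monom 1 j) (Suc i)" for i j
    by (simp add: monom_Suc)
  have ym: "poly_y * monom (monom 1 j) i = monom (monom 1 (Suc j)) i" for i j
    by (simp add: monom_Suc smult_monom)
  have "tutte_poly r (rank_matroid E \<rho>) = (\<Sum>B\<in>rank_bases E \<rho>. ?m E \<rho> B)"
    by (simp add: tutte_poly_def bases_rank_matroid)
  also have "rank_bases E \<rho> = {B\<in>rank_bases E \<rho>. e \<notin> B} \<union> {B\<in>rank_bases E \<rho>. e \<in> B}" by auto
  also have "(\<Sum>B\<in>\<dots>. ?m E \<rho> B) = (\<Sum>B | B\<in>rank_bases E \<rho> \<and> e \<notin> B. ?m E \<rho> B) +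
      (\<Sum>B | B\<in>rank_bases E \<rho> \<and> e \<in> B. ?m E \<rho> B)"
    using finite_rank_bases by (intro sum.union_disjoint) auto
  also have "(\<Sum>B | B\<in>rank_bases E \<rho> \<and> e \<notin> B. ?m E \<rho> B) = (if \<rho> ?F < \<rho> E then 0
     else (if \<rho> {e} = 0 then poly_y else 1) * tutte_poly r (rank_matroid ?F \<rho>))"
  proof (cases "\<rho> ?F < \<rho> E")
    case True
    then have "{B. B\<in>rank_bases E \<rho> \<and> e \<notin> B} = {}" using not_coloop_of_basis by fastforce
    then show ?thesis using True by (simp only: sum.empty if_True refl)
  next
    case False
    then have eq: "\<rho> ?F = \<rho> E" using rank_delete[OF e] by auto
    have "{B. B\<in>rank_bases E \<rho> \<and> e \<notin> B} = rank_bases ?F \<rho>"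
      using eq by (auto simp: rank_bases_def)
    moreover have "?m E \<rho> B = (if \<rho> {e} = 0 then poly_y else 1) * ?m ?F \<rho> B"
      if "B \<in> rank_bases ?F \<rho>" for B
    proof -
      have "B \<subseteq> ?F" using that by (auto simp: rank_bases_def)
      then have "B \<in> rank_bases E \<rho>" "e \<notin> B" using that eq by (auto simp: rank_bases_delete)
      then show ?thesis using activities_delete[of B] by (auto simp: ym simp del: mult_pCons_left)
    qed
    ultimately show ?thesis using False
      by (simp add: tutte_poly_def D.bases_rank_matroid sum_distrib_left)
  qed
  also have "(\<Sum>B | B\<in>rank_bases E \<rho> \<and> e \<in> B. ?m E \<rho> B) = (if \<rho> {e} = 0 then 0
     else (if \<rho> ?F < \<rho> E then poly_x else 1) * tutte_poly r (rank_matroid ?F ?\<sigma>))"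
  proof (cases "\<rho> {e} = 0")
    case True
    then have "{B. B\<in>rank_bases E \<rho> \<and> e \<in> B} = {}" using not_loop_of_basis by blast
    then show ?thesis using True by (simp only: sum.empty if_True refl)
  next
    case False
    have sub: "B \<subseteq> ?F" if "B \<in> rank_bases ?F ?\<sigma>" for B using that by (auto simp: rank_bases_def)
    have "{B. B\<in>rank_bases E \<rho> \<and> e \<in> B} = insert e ` rank_bases ?F ?\<sigma>"
    proof (intro set_eqI iffI)
      fix B assume "B \<in> {B. B\<in>rank_bases E \<rho> \<and> e \<in> B}"
      then have B: "B \<in> rank_bases E \<rho>" "e \<in> B" "B - {e} \<subseteq> ?F" by (auto simp: rank_bases_def)
      then have "B - {e} \<in> rank_bases ?F ?\<sigma>"
        using rank_bases_contract[OF e False, of "B - {e}"] by (simp add: insert_absorb)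
      then show "B \<in> insert e ` rank_bases ?F ?\<sigma>" using B by (auto intro!: image_eqI[of _ _ "B - {e}"])
    next
      fix B assume "B \<in> insert e ` rank_bases ?F ?\<sigma>"
      then show "B \<in> {B. B\<in>rank_bases E \<rho> \<and> e \<in> B}"
        using rank_bases_contract[OF e False] sub by auto
    qed
    moreover have "inj_on (insert e) (rank_bases ?F ?\<sigma>)"
      using sub by (intro inj_onI) (metis Diff_insert_absorb Diff_iff insertI1 subsetD)
    moreover have "?m E \<rho> (insert e B) = (if \<rho> ?F < \<rho> E then poly_x else 1) * ?m ?F ?\<sigma> B"
      if "B \<in> rank_bases ?F ?\<sigma>" for B
    proof -
      have "insert e B \<in> rank_bases E \<rho>" "e \<notin> B"
        using that sub[OF that] False e by (auto simp: rank_bases_contract)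
      then show ?thesis using activities_contract[of B] by (auto simp: xm simp del: mult_pCons_left)
    qed
    ultimately show ?thesis using False
      by (simp add: tutte_poly_def C.bases_rank_matroid sum_distrib_left sum.reindex)
  qed
  finally show ?thesis .
qed

end

end

lemma tutte_poly_eq_rank_poly:
  assumes "rank_function E \<rho>" "linear_order_among r E"
  shows "tutte_poly r (rank_matroid E \<rho>) = rank_poly E \<rho>"
  using assms
proof (induction "card E" arbitrary: E \<rho> rule: less_induct)
  case less
  interpret rank_function E \<rho> by (rule less.prems)
  show ?case
  proof (cases "E = {}")
    case True
    have "rank_bases {} \<rho> = {{}}" using True by (auto simp: rank_bases_def)
    then show ?thesis using bases_rank_matroid True
      by (simp add: tutte_poly_def rank_poly_def internal_activity_def external_activity_def)
  next
    case False
    then obtain e where e: "e \<in> E" "\<forall>x\<in>E. (x, e) \<in> r"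
      using greatest_exists[OF fin] less.prems by blast
    have card: "card (E - {e}) < card E" using e fin by (intro psubset_card_mono) auto
    have r: "linear_order_among r (E - {e})" using less.prems(2) by (rule linear_order_among_subset) auto
    have D: "tutte_poly r (rank_matroid (E - {e}) \<rho>) = rank_poly (E - {e}) \<rho>"
      using less.hyps[OF card restrict r] by auto
    have C: "tutte_poly r (rank_matroid (E - {e}) (contract_rank {e} \<rho>)) =
        rank_poly (E - {e}) (contract_rank {e} \<rho>)"
      using less.hyps[OF card contract r] e by auto
    note split = tutte_poly_split[OF less.prems(2) e, unfolded D C]
    consider "\<rho> {e} = 0" | "\<rho> (E - {e}) < \<rho> E" | "\<rho> {e} \<noteq> 0" "\<rho> (E - {e}) = \<rho> E"
      using rank_delete[OF e(1)] by linarith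
    then show ?thesis
    proof cases
      case 1
      moreover have "\<not> \<rho> (E - {e}) < \<rho> E" using 1 rank_delete[OF e(1)] by auto
      ultimately show ?thesis using split rank_poly_loop[OF e(1)] by simp
    next
      case 2
      moreover have "\<rho> {e} \<noteq> 0" using 2 rank_delete[OF e(1)] by auto
      \<comment> \<open>For a coloop the activity recursion retains only the contraction, whereas
        \<open>rank_poly_coloop\<close> speaks of the deletion, so the two have to be
        identified.\<close>
      moreover have "rank_poly (E - {e}) (contract_rank {e} \<rho>) = rank_poly (E - {e}) \<rho>"
        using contract_rank_coloop[OF e(1) 2] by (intro rank_poly_cong) auto
      ultimately show ?thesis using split rank_poly_coloop[OF e(1)] by simp
    next
      case 3
      then show ?thesis using split rank_poly_delete_contract[OF e(1)] by simp
    qed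
  qed
qed

section \<open>Coefficients and minors\<close>

definition rank_coeff :: "'a set \<Rightarrow> ('a set \<Rightarrow> nat) \<Rightarrow> nat \<Rightarrow> nat \<Rightarrow> int" where
  "rank_coeff E \<rho> i j = coeff (coeff (rank_poly E \<rho>) i) j"

lemma rank_coeff_cong:
  "(\<And>A. A \<subseteq> E \<Longrightarrow> \<rho> A = \<sigma> A) \<Longrightarrow> rank_coeff E \<rho> = rank_coeff E \<sigma>"
  using rank_poly_cong[of E \<rho> \<sigma>] by (simp add: rank_coeff_def fun_eq_iff)

lemma rank_coeff_empty: "rank_coeff {} \<rho> i j = (if i = 0 \<and> j = 0 then 1 else 0)"
  by (auto simp: rank_coeff_def rank_poly_def coeff_1)

lemma minor_cases [case_names loop coloop proper]:
  assumes "rank_function E \<rho>" "v \<in> E"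
  obtains "\<rho> {v} = 0" | "\<rho> (E - {v}) < \<rho> E" | "\<rho> {v} \<noteq> 0" "\<rho> (E - {v}) = \<rho> E"
  using rank_function.rank_delete[OF assms] by linarith

text \<open>Loops and coloops are given only the hypothesis for the deletion, because the
  contraction has the same rank function there.\<close>

lemma minor_induct [consumes 1, case_names empty loop coloop proper]:
  assumes "rank_function E \<rho>"
    and empty: "\<And>\<rho>. P {} \<rho>"
    and loop: "\<And>E \<rho> v. rank_function E \<rho> \<Longrightarrow> v \<in> E \<Longrightarrow> \<rho> {v} = 0 \<Longrightarrow> P (E - {v}) \<rho> \<Longrightarrow> P E \<rho>"
    and coloop: "\<And>E \<rho> v. rank_function E \<rho> \<Longrightarrow> v \<in> E \<Longrightarrow> \<rho> (E - {v}) < \<rho> E \<Longrightarrow> P (E - {v}) \<rho> \<Longrightarrow> P E \<rho>"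
    and proper: "\<And>E \<rho> v. rank_function E \<rho> \<Longrightarrow> v \<in> E \<Longrightarrow> \<rho> {v} \<noteq> 0 \<Longrightarrow> \<rho> (E - {v}) = \<rho> E \<Longrightarrow>
      P (E - {v}) \<rho> \<Longrightarrow> P (E - {v}) (contract_rank {v} \<rho>) \<Longrightarrow> P E \<rho>"
  shows "P E \<rho>"
  using assms(1)
proof (induction "card E" arbitrary: E \<rho> rule: less_induct)
  case less
  interpret rank_function E \<rho> by (rule less.prems)
  show ?case
  proof (cases "E = {}")
    case True
    then show ?thesis using empty by simp
  next
    case False
    then obtain v where v: "v \<in> E" by auto
    have card: "card (E - {v}) < card E" using v fin by (intro psubset_card_mono) auto
    have D: "P (E - {v}) \<rho>" by (rule less.hyps[OF card restrict]) auto
    have C: "P (E - {v}) (contract_rank {v} \<rho>)" using v by (intro less.hyps[OF card contract]) auto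
    from less.prems v show ?thesis
      by (cases rule: minor_cases) (use loop coloop proper less.prems v D C in blast)+
  qed
qed

text \<open>The set \<open>X\<close> is contracted; \<open>K\<close> and \<open>L\<close> become the coloops and the loops.\<close>

definition has_kl_minor :: "nat \<Rightarrow> nat \<Rightarrow> 'a set \<Rightarrow> ('a set \<Rightarrow> nat) \<Rightarrow> bool" where
  "has_kl_minor k l E \<rho> \<longleftrightarrow> (\<exists>X K L. X \<subseteq> E \<and> K \<subseteq> E \<and> L \<subseteq> E \<and>
     X \<inter> K = {} \<and> X \<inter> L = {} \<and> K \<inter> L = {} \<and> card K = k \<and> card L = l \<and>
     \<rho> (X \<union> K) = \<rho> X + k \<and> \<rho> (X \<union> L) = \<rho> X)"

lemma has_kl_minorI:
  "\<lbrakk>X \<subseteq> E; K \<subseteq> E; L \<subseteq> E; X \<inter> K = {}; X \<inter> L = {}; K \<inter> L = {}; card K = k; card L = l;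
    \<rho> (X \<union> K) = \<rho> X + k; \<rho> (X \<union> L) = \<rho> X\<rbrakk> \<Longrightarrow> has_kl_minor k l E \<rho>"
  unfolding has_kl_minor_def by blast

lemma has_kl_minorE:
  assumes "has_kl_minor k l E \<rho>"
  obtains X K L where "X \<subseteq> E" "K \<subseteq> E" "L \<subseteq> E" "X \<inter> K = {}" "X \<inter> L = {}" "K \<inter> L = {}"
    "card K = k" "card L = l" "\<rho> (X \<union> K) = \<rho> X + k" "\<rho> (X \<union> L) = \<rho> X"
  using assms unfolding has_kl_minor_def by blast

lemma has_kl_minor_cong:
  assumes "\<And>A. A \<subseteq> E \<Longrightarrow> \<rho> A = \<sigma> A"
  shows "has_kl_minor k l E \<rho> \<longleftrightarrow> has_kl_minor k l E \<sigma>"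
proof -
  have *: "has_kl_minor k l E \<tau>" if "has_kl_minor k l E \<rho>" and eq: "\<And>A. A \<subseteq> E \<Longrightarrow> \<rho> A = \<tau> A" for \<rho> \<tau>
    using that(1)
  proof (rule has_kl_minorE)
    fix X K L assume XKL: "X \<subseteq> E" "K \<subseteq> E" "L \<subseteq> E" "X \<inter> K = {}" "X \<inter> L = {}" "K \<inter> L = {}"
      "card K = k" "card L = l" "\<rho> (X \<union> K) = \<rho> X + k" "\<rho> (X \<union> L) = \<rho> X"
    then show ?thesis using eq[of X] eq[of "X \<union> K"] eq[of "X \<union> L"]
      by (intro has_kl_minorI[of X E K L]) auto
  qed
  from *[of \<rho> \<sigma>] *[of \<sigma> \<rho>] assms show ?thesis by auto
qed

context rank_function
begin

lemma has_kl_minor_delete: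
  assumes "has_kl_minor k l (E - {v}) \<rho>"
  shows "has_kl_minor k l E \<rho>"
  using assms
proof (rule has_kl_minorE)
  fix X K L assume "X \<subseteq> E - {v}" "K \<subseteq> E - {v}" "L \<subseteq> E - {v}" "X \<inter> K = {}" "X \<inter> L = {}"
    "K \<inter> L = {}" "card K = k" "card L = l" "\<rho> (X \<union> K) = \<rho> X + k" "\<rho> (X \<union> L) = \<rho> X"
  then show ?thesis by (intro has_kl_minorI[of X E K L]) auto
qed

lemma has_kl_minor_contract:
  assumes v: "v \<in> E" and "has_kl_minor k l (E - {v}) (contract_rank {v} \<rho>)"
  shows "has_kl_minor k l E \<rho>"
  using assms(2)
proof (rule has_kl_minorE)
  fix X K L
  assume XKL: "X \<subseteq> E - {v}" "K \<subseteq> E - {v}" "L \<subseteq> E - {v}" "X \<inter> K = {}" "X \<inter> L = {}" "K \<inter> L = {}"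
    "card K = k" "card L = l"
    and rk: "contract_rank {v} \<rho> (X \<union> K) = contract_rank {v} \<rho> X + k"
      "contract_rank {v} \<rho> (X \<union> L) = contract_rank {v} \<rho> X"
  have "\<rho> {v} \<le> \<rho> (insert v A)" if "A \<subseteq> E" for A using that v by (intro rank_mono) auto
  moreover have "X \<subseteq> E" "X \<union> K \<subseteq> E" "X \<union> L \<subseteq> E" using XKL by auto
  ultimately have "\<rho> {v} \<le> \<rho> (insert v X)" "\<rho> {v} \<le> \<rho> (insert v (X \<union> K))"
    "\<rho> {v} \<le> \<rho> (insert v (X \<union> L))" by blast+
  with rk
  have "\<rho> (insert v X \<union> K) = \<rho> (insert v X) + k" "\<rho> (insert v X \<union> L) = \<rho> (insert v X)"
    by (auto simp: contract_rank_def)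
  then show ?thesis using XKL v by (intro has_kl_minorI[of "insert v X" E K L]) auto
qed

lemma has_kl_minor_add_loop:
  assumes v: "v \<in> E" "\<rho> {v} = 0" and "has_kl_minor k l (E - {v}) \<rho>"
  shows "has_kl_minor k (Suc l) E \<rho>"
  using assms(3)
proof (rule has_kl_minorE)
  fix X K L
  assume XKL: "X \<subseteq> E - {v}" "K \<subseteq> E - {v}" "L \<subseteq> E - {v}" "X \<inter> K = {}" "X \<inter> L = {}" "K \<inter> L = {}"
    "card K = k" "card L = l" "\<rho> (X \<union> K) = \<rho> X + k" and L: "\<rho> (X \<union> L) = \<rho> X"
  have "\<rho> (insert v (X \<union> L)) = \<rho> (X \<union> L)"
    using contract_rank_loop[OF v, of "X \<union> L"] v XKL by (auto simp: contract_rank_def)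
  moreover have "card (insert v L) = Suc l"
    using XKL finite_subset_ground[of L] by (subst card_insert_disjoint) auto
  ultimately show ?thesis using XKL L v by (intro has_kl_minorI[of X E K "insert v L"]) auto
qed

lemma has_kl_minor_add_coloop:
  assumes v: "v \<in> E" "\<rho> (E - {v}) < \<rho> E" and "has_kl_minor k l (E - {v}) \<rho>"
  shows "has_kl_minor (Suc k) l E \<rho>"
  using assms(3)
proof (rule has_kl_minorE)
  fix X K L
  assume XKL: "X \<subseteq> E - {v}" "K \<subseteq> E - {v}" "L \<subseteq> E - {v}" "X \<inter> K = {}" "X \<inter> L = {}" "K \<inter> L = {}"
    "card K = k" "card L = l" "\<rho> (X \<union> L) = \<rho> X" and K: "\<rho> (X \<union> K) = \<rho> X + k"
  have "\<rho> {v} = 1" using rank_delete[OF v(1)] rank_singleton[OF v(1)] v by auto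
  moreover have "\<rho> {v} \<le> \<rho> (insert v (X \<union> K))" using v XKL by (intro rank_mono) auto
  \<comment> \<open>A coloop raises the rank of every set avoiding it by one, so it remains a coloop
    after contracting \<open>X\<close> and can join \<open>K\<close>.\<close>
  ultimately have "\<rho> (insert v (X \<union> K)) = Suc (\<rho> (X \<union> K))"
    using contract_rank_coloop[OF v, of "X \<union> K"] XKL by (auto simp: contract_rank_def)
  moreover have "card (insert v K) = Suc k"
    using XKL finite_subset_ground[of K] by (subst card_insert_disjoint) auto
  ultimately show ?thesis using XKL K v by (intro has_kl_minorI[of X E "insert v K" L]) auto
qed

text \<open>Surplus elements of \<open>K\<close> and \<open>L\<close> are discarded. Discarding
  \<open>i - k\<close> elements of \<open>K\<close> lowers the rank by at most that many, and
  \<open>L'\<close> is squeezed between \<open>X\<close> and \<open>X \<union> L\<close>.\<close>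

lemma has_kl_minor_mono:
  assumes "has_kl_minor i j E \<rho>" "k \<le> i" "l \<le> j"
  shows "has_kl_minor k l E \<rho>"
  using assms(1)
proof (rule has_kl_minorE)
  fix X K L
  assume XKL: "X \<subseteq> E" "K \<subseteq> E" "L \<subseteq> E" "X \<inter> K = {}" "X \<inter> L = {}" "K \<inter> L = {}"
    "card K = i" "card L = j" "\<rho> (X \<union> K) = \<rho> X + i" "\<rho> (X \<union> L) = \<rho> X"
  obtain K' L' where K': "K' \<subseteq> K" "card K' = k" and L': "L' \<subseteq> L" "card L' = l"
    using obtain_subset_with_card_n assms XKL by metis
  have KE: "K' \<subseteq> E" and LE: "L' \<subseteq> E" and finK: "finite K"
    using K' L' XKL finite_subset_ground by auto
  have "\<rho> (X \<union> K) \<le> \<rho> (X \<union> K') + card ((X \<union> K) - (X \<union> K'))"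
    using XKL K' by (intro rank_le_diff) auto
  also have "card ((X \<union> K) - (X \<union> K')) \<le> card (K - K')" using finK by (intro card_mono) auto
  also have "\<dots> = i - k" using K' XKL finK by (simp add: card_Diff_subset finite_subset)
  finally have "\<rho> X + k \<le> \<rho> (X \<union> K')" using XKL assms by auto
  moreover have "\<rho> (X \<union> K') \<le> \<rho> X + k"
    using rank_Un_le[OF XKL(1) KE] rank_le_card[OF KE] K' by auto
  ultimately have rK: "\<rho> (X \<union> K') = \<rho> X + k" by simp
  have "\<rho> X \<le> \<rho> (X \<union> L')" using XKL LE by (intro rank_mono) auto
  moreover have "\<rho> (X \<union> L') \<le> \<rho> (X \<union> L)" using XKL L' by (intro rank_mono) auto
  ultimately have rL: "\<rho> (X \<union> L') = \<rho> X" using XKL by simp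
  show ?thesis by (rule has_kl_minorI[OF XKL(1) KE LE _ _ _ _ _ rK rL]) (use XKL K' L' in auto)
qed

section \<open>Nonzero coefficients correspond to minors\<close>

lemma rank_coeff_loop:
  assumes "v \<in> E" "\<rho> {v} = 0"
  shows "rank_coeff E \<rho> i j = (case j of 0 \<Rightarrow> 0 | Suc j' \<Rightarrow> rank_coeff (E - {v}) \<rho> i j')"
  unfolding rank_coeff_def rank_poly_loop[OF assms] by (simp add: coeff_pCons split: nat.split)

lemma rank_coeff_coloop:
  assumes "v \<in> E" "\<rho> (E - {v}) < \<rho> E"
  shows "rank_coeff E \<rho> i j = (case i of 0 \<Rightarrow> 0 | Suc i' \<Rightarrow> rank_coeff (E - {v}) \<rho> i' j)"
  unfolding rank_coeff_def rank_poly_coloop[OF assms] by (simp add: coeff_pCons split: nat.split)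

lemma rank_coeff_proper:
  assumes "v \<in> E" "\<rho> {v} \<noteq> 0" "\<rho> (E - {v}) = \<rho> E"
  shows "rank_coeff E \<rho> i j =
    rank_coeff (E - {v}) \<rho> i j + rank_coeff (E - {v}) (contract_rank {v} \<rho>) i j"
  unfolding rank_coeff_def rank_poly_delete_contract[OF assms] by simp

end

text \<open>The powers of x - 1 and y - 1 hide the signs, but the recursion only shifts and adds
  coefficients.\<close>

lemma rank_coeff_nonneg:
  "rank_function E \<rho> \<Longrightarrow> 0 \<le> rank_coeff E \<rho> i j"
proof (induction arbitrary: i j rule: minor_induct)
  case (loop E \<rho> v)
  then show ?case by (simp add: rank_function.rank_coeff_loop[of E \<rho> v] split: nat.split)
next
  case (coloop E \<rho> v)
  then show ?case by (simp add: rank_function.rank_coeff_coloop[of E \<rho> v] split: nat.split)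
next
  case (proper E \<rho> v)
  then show ?case by (simp add: rank_function.rank_coeff_proper[of E \<rho> v])
qed (simp add: rank_coeff_empty)

text \<open>Each step of the recursion is matched by one on minors: a loop joins \<open>L\<close>, a
  coloop joins \<open>K\<close>, and a minor of a deletion or contraction is a minor of the whole.
  The exponents are matched exactly.\<close>

lemma has_kl_minor_of_rank_coeff:
  "rank_function E \<rho> \<Longrightarrow> rank_coeff E \<rho> i j \<noteq> 0 \<Longrightarrow> has_kl_minor i j E \<rho>"
proof (induction arbitrary: i j rule: minor_induct)
  case (empty \<rho>)
  then show ?case by (simp add: rank_coeff_empty has_kl_minor_def split: if_splits)
next
  case (loop E \<rho> v)
  then obtain j' where "j = Suc j'" "rank_coeff (E - {v}) \<rho> i j' \<noteq> 0"
    by (auto simp: rank_function.rank_coeff_loop[of E \<rho> v] split: nat.splits)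
  then show ?case using loop rank_function.has_kl_minor_add_loop by metis
next
  case (coloop E \<rho> v)
  then obtain i' where "i = Suc i'" "rank_coeff (E - {v}) \<rho> i' j \<noteq> 0"
    by (auto simp: rank_function.rank_coeff_coloop[of E \<rho> v] split: nat.splits)
  then show ?case using coloop rank_function.has_kl_minor_add_coloop by metis
next
  case (proper E \<rho> v)
  then have "rank_coeff (E - {v}) \<rho> i j \<noteq> 0 \<or> rank_coeff (E - {v}) (contract_rank {v} \<rho>) i j \<noteq> 0"
    by (auto simp: rank_function.rank_coeff_proper[of E \<rho> v])
  then show ?case
    using proper rank_function.has_kl_minor_delete rank_function.has_kl_minor_contract by metis
qed

text \<open>Nonnegativity prevents cancellation between the two minors. A loop or coloop moves the
  coefficient one step up, which is why only lower bounds on the new exponents are claimed.\<close>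

lemma (in rank_function) rank_coeff_lift:
  assumes v: "v \<in> E"
    and "rank_coeff (E - {v}) \<rho> i j \<noteq> 0 \<or> rank_coeff (E - {v}) (contract_rank {v} \<rho>) i j \<noteq> 0"
  shows "\<exists>i'\<ge>i. \<exists>j'\<ge>j. rank_coeff E \<rho> i' j' \<noteq> 0"
  using rank_function_axioms v
proof (cases rule: minor_cases)
  case loop
  then have "rank_coeff (E - {v}) (contract_rank {v} \<rho>) = rank_coeff (E - {v}) \<rho>"
    using contract_rank_loop v by (intro rank_coeff_cong) auto
  then have "rank_coeff E \<rho> i (Suc j) \<noteq> 0" using assms loop by (simp add: rank_coeff_loop[of v])
  then show ?thesis using le_SucI by blast
next
  case coloop
  then have "rank_coeff (E - {v}) (contract_rank {v} \<rho>) = rank_coeff (E - {v}) \<rho>"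
    using contract_rank_coloop v by (intro rank_coeff_cong) auto
  then have "rank_coeff E \<rho> (Suc i) j \<noteq> 0" using assms coloop by (simp add: rank_coeff_coloop[of v])
  then show ?thesis using le_SucI by blast
next
  case proper
  have "0 \<le> rank_coeff (E - {v}) \<rho> i j" "0 \<le> rank_coeff (E - {v}) (contract_rank {v} \<rho>) i j"
    using v by (auto intro!: rank_coeff_nonneg restrict contract)
  then have "rank_coeff E \<rho> i j \<noteq> 0"
    using assms(2) rank_coeff_proper[OF v proper, of i j] by linarith
  then show ?thesis by blast
qed

text \<open>Elements outside \<open>K\<close> and \<open>L\<close> are removed first, contracted if
  in \<open>X\<close> and deleted otherwise, so that the minor survives. Once
  \<open>E = K \<union> L\<close>, the set \<open>X\<close> is empty and the elements are coloops
  and loops, which are peeled off one by one.\<close>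

lemma rank_coeff_of_has_kl_minor:
  assumes "rank_function E \<rho>" "has_kl_minor k l E \<rho>"
  shows "\<exists>i\<ge>k. \<exists>j\<ge>l. rank_coeff E \<rho> i j \<noteq> 0"
  using assms
proof (induction "card E" arbitrary: E \<rho> k l rule: less_induct)
  case less
  interpret rank_function E \<rho> by (rule less.prems)
  have card: "card (E - {v}) < card E" if "v \<in> E" for v
    using that fin by (intro psubset_card_mono) auto
  have D: "\<exists>i\<ge>k. \<exists>j\<ge>l. rank_coeff (E - {v}) \<rho> i j \<noteq> 0"
    if "v \<in> E" "has_kl_minor k l (E - {v}) \<rho>" for v k l
    using less.hyps[OF card restrict] that by auto
  from less.prems(2) obtain X K L where XKL: "X \<subseteq> E" "K \<subseteq> E" "L \<subseteq> E" "X \<inter> K = {}" "X \<inter> L = {}"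
    "K \<inter> L = {}" "card K = k" "card L = l" "\<rho> (X \<union> K) = \<rho> X + k" "\<rho> (X \<union> L) = \<rho> X"
    by (rule has_kl_minorE)
  have finK: "finite K" and finL: "finite L" using XKL finite_subset_ground by auto
  consider (out) v where "v \<in> E" "v \<notin> K" "v \<notin> L" | (K) v where "E = K \<union> L" "v \<in> K"
    | (L) v where "E = K \<union> L" "v \<in> L" | (E) "E = {}"
    using XKL(2,3) by blast
  then show ?case
  proof cases
    case out
    have "\<exists>i\<ge>k. \<exists>j\<ge>l. rank_coeff (E - {v}) \<rho> i j \<noteq> 0 \<or>
        rank_coeff (E - {v}) (contract_rank {v} \<rho>) i j \<noteq> 0"
    proof (cases "v \<in> X")
      case True
      then have ins: "(X - {v}) \<union> A \<union> {v} = X \<union> A" for A by auto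
      have ins': "insert v X = X" "X \<union> {v} = X" using True by auto
      have "\<rho> {v} \<le> \<rho> X" using True XKL by (intro rank_mono) auto
      then have "has_kl_minor k l (E - {v}) (contract_rank {v} \<rho>)"
        using XKL out
        by (intro has_kl_minorI[of "X - {v}" _ K L]) (auto simp: contract_rank_def ins ins' simp del: Un_insert_right)
      then show ?thesis using less.hyps[OF card[OF out(1)] contract] out by fastforce
    next
      case False
      then have "has_kl_minor k l (E - {v}) \<rho>"
        using XKL out by (intro has_kl_minorI[of X _ K L]) auto
      then show ?thesis using D[OF out(1)] by blast
    qed
    then obtain i j where ij: "i \<ge> k" "j \<ge> l" "rank_coeff (E - {v}) \<rho> i j \<noteq> 0 \<or>
        rank_coeff (E - {v}) (contract_rank {v} \<rho>) i j \<noteq> 0" by blast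
    then show ?thesis using rank_coeff_lift[OF out(1) ij(3)] by (meson order_trans)
  next
    case K
    have X: "X = {}" using K XKL by auto
    \<comment> \<open>\<open>L\<close> has rank 0 and \<open>K - {v}\<close> has only
      \<open>k - 1\<close> elements, so \<open>E - {v}\<close> has rank below \<open>k\<close>,
      while \<open>K\<close> alone has rank \<open>k\<close>: thus \<open>v\<close> is a
      coloop.\<close>
    have "\<rho> ((K - {v}) \<union> L) \<le> \<rho> (K - {v}) + \<rho> L" using XKL by (intro rank_Un_le) auto
    moreover have "(K - {v}) \<union> L = E - {v}" using K XKL by auto
    moreover have "\<rho> (K - {v}) \<le> card (K - {v})" using XKL by (intro rank_le_card) auto
    moreover have cK: "card (K - {v}) = k - 1" "k \<ge> 1"
      using K XKL finK by (auto simp: Suc_le_eq card_gt_0_iff)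
    moreover have "\<rho> K \<le> \<rho> E" using XKL by (intro rank_mono) auto
    ultimately have co: "\<rho> (E - {v}) < \<rho> E" using XKL X by auto
    have v: "v \<in> E" using K by auto
    have "\<rho> (K - {v}) = card (K - {v})" using indep_subset_rank[of K "K - {v}"] XKL X by auto
    then have "has_kl_minor (k - 1) l (E - {v}) \<rho>"
      using XKL K X cK by (intro has_kl_minorI[of "{}" _ "K - {v}" L]) auto
    then obtain i j where ij: "i \<ge> k - 1" "j \<ge> l" "rank_coeff (E - {v}) \<rho> i j \<noteq> 0"
      using D[OF v] by blast
    then show ?thesis using co v by (intro exI[of _ "Suc i"] conjI exI[of _ j]) (auto simp: rank_coeff_coloop[of v])
  next
    case L
    have X: "X = {}" using L XKL by auto
    have v: "v \<in> E" using L by auto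
    have "\<rho> {v} \<le> \<rho> L" "\<rho> (L - {v}) \<le> \<rho> L" using L XKL by (auto intro!: rank_mono)
    then have lo: "\<rho> {v} = 0" and L0: "\<rho> (L - {v}) = 0" using XKL X by auto
    have cL: "card (L - {v}) = l - 1" "l \<ge> 1"
      using L XKL finL by (auto simp: Suc_le_eq card_gt_0_iff)
    then have "has_kl_minor k (l - 1) (E - {v}) \<rho>"
      using XKL L X L0 by (intro has_kl_minorI[of "{}" _ K "L - {v}"]) auto
    then obtain i j where ij: "i \<ge> k" "j \<ge> l - 1" "rank_coeff (E - {v}) \<rho> i j \<noteq> 0"
      using D[OF v] by blast
    then show ?thesis using lo v by (intro exI[of _ i] conjI exI[of _ "Suc j"]) (auto simp: rank_coeff_loop[of v])
  next
    case E
    then show ?thesis using XKL by (intro exI[of _ 0]) (auto simp: rank_coeff_empty)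
  qed
qed

section \<open>Almost uniformity and the coefficient condition\<close>

definition almost_no_kl_minor :: "nat \<Rightarrow> nat \<Rightarrow> 'a set \<Rightarrow> ('a set \<Rightarrow> nat) \<Rightarrow> bool" where
  "almost_no_kl_minor k l E \<rho> \<longleftrightarrow> (\<forall>v\<in>E. \<not> has_kl_minor k l (E - {v}) \<rho> \<or>
     \<not> has_kl_minor k l (E - {v}) (contract_rank {v} \<rho>))"

context rank_function
begin

lemma contract_rank_commute:
  assumes "u \<in> E" "v \<in> E"
  shows "contract_rank {u} (contract_rank {v} \<rho>) = contract_rank {v} (contract_rank {u} \<rho>)"
proof
  fix A
  have "\<rho> {v} \<le> \<rho> {u, v}" "\<rho> {u} \<le> \<rho> {u, v}" using assms by (auto intro: rank_mono)
  then show "contract_rank {u} (contract_rank {v} \<rho>) A = contract_rank {v} (contract_rank {u} \<rho>) A"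
    by (simp add: contract_rank_def insert_commute)
qed

text \<open>Removals of different elements commute. If both ways of removing \<open>u\<close> after
  deleting \<open>v\<close> kept the forbidden minor, then so would both ways of removing
  \<open>u\<close> from the whole.\<close>

lemma almost_no_kl_minor_delete:
  assumes "almost_no_kl_minor k l E \<rho>"
  shows "almost_no_kl_minor k l (E - {v}) \<rho>"
  unfolding almost_no_kl_minor_def
proof
  fix u assume u: "u \<in> E - {v}"
  interpret D: rank_function "E - {u}" \<rho> by (rule restrict) auto
  interpret C: rank_function "E - {u}" "contract_rank {u} \<rho>" using u by (intro contract) auto
  have "E - {v} - {u} = E - {u} - {v}" by auto
  then show "\<not> has_kl_minor k l (E - {v} - {u}) \<rho> \<or>
      \<not> has_kl_minor k l (E - {v} - {u}) (contract_rank {u} \<rho>)"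
    using assms u D.has_kl_minor_delete[of k l v] C.has_kl_minor_delete[of k l v]
    by (auto simp: almost_no_kl_minor_def)
qed

text \<open>The argument for deletion carries over, with \<open>contract_rank_commute\<close>
  exchanging two contractions.\<close>

lemma almost_no_kl_minor_contract:
  assumes "almost_no_kl_minor k l E \<rho>" and v: "v \<in> E"
  shows "almost_no_kl_minor k l (E - {v}) (contract_rank {v} \<rho>)"
  unfolding almost_no_kl_minor_def
proof
  fix u assume u: "u \<in> E - {v}"
  interpret D: rank_function "E - {u}" \<rho> by (rule restrict) auto
  interpret C: rank_function "E - {u}" "contract_rank {u} \<rho>" using u by (intro contract) auto
  have "E - {v} - {u} = E - {u} - {v}" by auto
  moreover have "contract_rank {u} (contract_rank {v} \<rho>) = contract_rank {v} (contract_rank {u} \<rho>)"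
    using u v by (intro contract_rank_commute) auto
  ultimately show "\<not> has_kl_minor k l (E - {v} - {u}) (contract_rank {v} \<rho>) \<or>
      \<not> has_kl_minor k l (E - {v} - {u}) (contract_rank {u} (contract_rank {v} \<rho>))"
    using assms u D.has_kl_minor_contract[of v k l] C.has_kl_minor_contract[of v k l]
    by (auto simp: almost_no_kl_minor_def)
qed

text \<open>A minor only guarantees a nonzero coefficient somewhere above \<open>(k, l)\<close>, so
  the whole range has to appear; \<open>has_kl_minor_mono\<close> brings larger minors back to
  \<open>(k, l)\<close>.\<close>

lemma no_kl_minor_iff_rank_coeff:
  "\<not> has_kl_minor k l E \<rho> \<longleftrightarrow> (\<forall>i\<ge>k. \<forall>j\<ge>l. rank_coeff E \<rho> i j = 0)"
proof
  assume "\<not> has_kl_minor k l E \<rho>"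
  then show "\<forall>i\<ge>k. \<forall>j\<ge>l. rank_coeff E \<rho> i j = 0"
    using has_kl_minor_of_rank_coeff[OF rank_function_axioms] has_kl_minor_mono by metis
next
  assume "\<forall>i\<ge>k. \<forall>j\<ge>l. rank_coeff E \<rho> i j = 0"
  then show "\<not> has_kl_minor k l E \<rho>"
    using rank_coeff_of_has_kl_minor[OF rank_function_axioms, of k l] by auto
qed

end

text \<open>A coloop \<open>u\<close> adds its rank to every set avoiding it, in particular to
  \<open>E - {v} - {u}\<close>, so it stays a coloop after \<open>v\<close> is deleted.\<close>

lemma (in rank_function) loop_or_coloop_delete:
  assumes "u \<in> E - {v}" "\<rho> {u} = 0 \<or> \<rho> (E - {u}) < \<rho> E"
  shows "\<rho> {u} = 0 \<or> \<rho> (E - {v} - {u}) < \<rho> (E - {v})"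
proof (cases "\<rho> {u} = 0")
  case False
  have "contract_rank {u} \<rho> (E - {v} - {u}) = \<rho> (E - {v} - {u})"
    using assms False by (intro contract_rank_coloop) auto
  moreover have "E - {v} - {u} \<union> {u} = E - {v}" using assms by auto
  moreover have "\<rho> {u} \<le> \<rho> (E - {v})" using assms by (intro rank_mono) auto
  ultimately show ?thesis using False by (auto simp: contract_rank_def)
qed simp

text \<open>The polynomial is a single monomial with coefficient 1, as each removal merely
  multiplies by x or y; the proper case contradicts the hypothesis.\<close>

lemma rank_coeff_loops_coloops:
  assumes "rank_function E \<rho>" "\<forall>v\<in>E. \<rho> {v} = 0 \<or> \<rho> (E - {v}) < \<rho> E"
  shows "rank_coeff E \<rho> i j \<le> 1"
  using assms
proof (induction arbitrary: i j rule: minor_induct)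
  case (empty \<rho>)
  then show ?case by (simp add: rank_coeff_empty)
next
  case (loop E \<rho> v)
  interpret rank_function E \<rho> by fact
  have "\<rho> {u} = 0 \<or> \<rho> (E - {v} - {u}) < \<rho> (E - {v})" if "u \<in> E - {v}" for u
    using that loop.prems by (intro loop_or_coloop_delete) auto
  then show ?case using loop by (simp add: rank_coeff_loop[of v] split: nat.split)
next
  case (coloop E \<rho> v)
  interpret rank_function E \<rho> by fact
  have "\<rho> {u} = 0 \<or> \<rho> (E - {v} - {u}) < \<rho> (E - {v})" if "u \<in> E - {v}" for u
    using that coloop.prems by (intro loop_or_coloop_delete) auto
  then show ?case using coloop by (simp add: rank_coeff_coloop[of v] split: nat.split)
next
  case (proper E \<rho> v)
  then show ?case by auto
qed

text \<open>Deletion and contraction agree at every element, so almost uniformity forbids the minor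
  in each \<open>E - {v}\<close>. The minor found from a nonzero coefficient supplies a coloop (if
  \<open>i > k\<close>) or a loop (if \<open>j > l\<close>) to remove; the exponent drops by one but
  stays in the range where the coefficients of \<open>E - {v}\<close> vanish.\<close>

lemma (in rank_function) rank_coeff_loops_coloops_zero:
  assumes all: "\<forall>v\<in>E. \<rho> {v} = 0 \<or> \<rho> (E - {v}) < \<rho> E"
    and almost: "almost_no_kl_minor k l E \<rho>" and ij: "k \<le> i" "l \<le> j" "(i, j) \<noteq> (k, l)"
  shows "rank_coeff E \<rho> i j = 0"
proof (rule ccontr)
  assume nz: "rank_coeff E \<rho> i j \<noteq> 0"
  then have "has_kl_minor i j E \<rho>" by (rule has_kl_minor_of_rank_coeff[OF rank_function_axioms])
  then obtain X K L where XKL: "X \<subseteq> E" "K \<subseteq> E" "L \<subseteq> E" "X \<inter> K = {}" "X \<inter> L = {}" "K \<inter> L = {}"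
    "card K = i" "card L = j" "\<rho> (X \<union> K) = \<rho> X + i" "\<rho> (X \<union> L) = \<rho> X"
    by (rule has_kl_minorE)
  have no: "\<not> has_kl_minor k l (E - {v}) \<rho>" if v: "v \<in> E" for v
  proof -
    have "contract_rank {v} \<rho> A = \<rho> A" if "A \<subseteq> E - {v}" for A
    proof -
      have "A \<subseteq> E" using that by blast
      then show ?thesis
        using all v that contract_rank_loop contract_rank_coloop
        by (cases "\<rho> {v} = 0") (metis+)
    qed
    then have "has_kl_minor k l (E - {v}) (contract_rank {v} \<rho>) \<longleftrightarrow> has_kl_minor k l (E - {v}) \<rho>"
      by (rule has_kl_minor_cong)
    then show ?thesis using almost v by (auto simp: almost_no_kl_minor_def)
  qed
  have zero: "rank_coeff (E - {v}) \<rho> i' j' = 0" if "v \<in> E" "i' \<ge> k" "j' \<ge> l" for v i' j'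
    using rank_function.no_kl_minor_iff_rank_coeff[OF restrict, of "E - {v}" k l] no that by auto
  consider "i > k" | "j > l" using ij by (auto simp: le_less)
  then show False
  proof cases
    case 1
    then obtain v where v: "v \<in> K" using XKL by fastforce
    \<comment> \<open>A loop in \<open>K\<close> would leave at most \<open>i - 1\<close> elements
      to raise the rank of \<open>X\<close> by \<open>i\<close>.\<close>
    have "\<rho> {v} \<noteq> 0"
    proof
      assume l: "\<rho> {v} = 0"
      have "\<rho> (X \<union> K) = \<rho> (insert v (X \<union> (K - {v})))" using v by (intro arg_cong[of _ _ \<rho>]) auto
      also have "\<dots> \<le> \<rho> (X \<union> (K - {v})) + \<rho> {v}" using XKL v by (intro rank_insert_le) auto
      also have "\<dots> \<le> \<rho> X + \<rho> (K - {v})" using XKL l rank_Un_le[of X "K - {v}"] by auto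
      also have "\<dots> \<le> \<rho> X + card (K - {v})" using XKL rank_le_card[of "K - {v}"] by auto
      also have "\<dots> < \<rho> X + i" using v XKL fin by (metis add_strict_left_mono card_Diff1_less finite_subset)
      finally show False using XKL by simp
    qed
    moreover have vE: "v \<in> E" using v XKL by auto
    ultimately have co: "\<rho> (E - {v}) < \<rho> E" using all by auto
    then show False using nz zero[OF vE, of "i - 1" j] 1 ij
      by (cases i) (auto simp: rank_coeff_coloop[OF vE co])
  next
    case 2
    then obtain v where v: "v \<in> L" using XKL by fastforce
    then have vE: "v \<in> E" and vX: "X \<subseteq> E - {v}" using XKL by auto
    \<comment> \<open>Otherwise \<open>v\<close> would be a coloop outside \<open>X\<close>, and
      adding it would already raise the rank of \<open>X\<close>, against
      \<open>\<rho> (X \<union> L) = \<rho> X\<close>.\<close>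
    have "\<rho> {v} = 0"
    proof (rule ccontr)
      assume l: "\<rho> {v} \<noteq> 0"
      then have co: "\<rho> (E - {v}) < \<rho> E" using all vE by auto
      have "\<rho> {v} \<le> \<rho> (insert v X)" using vE XKL by (intro rank_mono) auto
      then have "\<rho> X < \<rho> (insert v X)"
        using contract_rank_coloop[OF vE co vX] l by (auto simp: contract_rank_def)
      also have "\<dots> \<le> \<rho> (X \<union> L)" using v XKL by (intro rank_mono) auto
      finally show False using XKL by simp
    qed
    then show False using nz zero[OF vE, of i "j - 1"] vE 2 ij
      by (cases j) (auto simp: rank_coeff_loop[of v])
  qed
qed

lemma rank_coeff_of_almost_no_kl_minor:
  assumes "rank_function E \<rho>" "almost_no_kl_minor k l E \<rho>"
  shows "rank_coeff E \<rho> k l \<le> 1 \<and>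
    (\<forall>i j. k \<le> i \<and> l \<le> j \<and> (i, j) \<noteq> (k, l) \<longrightarrow> rank_coeff E \<rho> i j = 0)"
  using assms
proof (induction "card E" arbitrary: E \<rho> rule: less_induct)
  case less
  interpret rank_function E \<rho> by (rule less.prems)
  show ?case
  proof (cases "\<forall>v\<in>E. \<rho> {v} = 0 \<or> \<rho> (E - {v}) < \<rho> E")
    case True
    then show ?thesis
      using rank_coeff_loops_coloops[OF less.prems(1)] rank_coeff_loops_coloops_zero less.prems(2)
      by blast
  next
    case False
    then obtain v where v: "v \<in> E" "\<rho> {v} \<noteq> 0" "\<rho> (E - {v}) = \<rho> E"
      using rank_delete by (meson le_antisym not_le)
    have card: "card (E - {v}) < card E" using v fin by (intro psubset_card_mono) auto
    interpret D: rank_function "E - {v}" \<rho> by (rule restrict) auto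
    interpret C: rank_function "E - {v}" "contract_rank {v} \<rho>" using v by (intro contract) auto
    note IHD = less.hyps[OF card D.rank_function_axioms almost_no_kl_minor_delete[OF less.prems(2)]]
    note IHC = less.hyps[OF card C.rank_function_axioms almost_no_kl_minor_contract[OF less.prems(2) v(1)]]
    consider "\<not> has_kl_minor k l (E - {v}) \<rho>" | "\<not> has_kl_minor k l (E - {v}) (contract_rank {v} \<rho>)"
      using less.prems v by (auto simp: almost_no_kl_minor_def)
    then show ?thesis
      by cases (use IHD IHC in \<open>auto simp: rank_coeff_proper[OF v] D.no_kl_minor_iff_rank_coeff
          C.no_kl_minor_iff_rank_coeff\<close>)
  qed
qed

lemma almost_no_kl_minor_of_rank_coeff:
  assumes "rank_function E \<rho>" and kl: "rank_coeff E \<rho> k l \<le> 1"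
    and zero: "\<And>i j. k \<le> i \<Longrightarrow> l \<le> j \<Longrightarrow> (i, j) \<noteq> (k, l) \<Longrightarrow> rank_coeff E \<rho> i j = 0"
  shows "almost_no_kl_minor k l E \<rho>"
  unfolding almost_no_kl_minor_def
proof (rule ballI, rule ccontr)
  fix v assume v: "v \<in> E"
    and "\<not> (\<not> has_kl_minor k l (E - {v}) \<rho> \<or> \<not> has_kl_minor k l (E - {v}) (contract_rank {v} \<rho>))"
  then have hD: "has_kl_minor k l (E - {v}) \<rho>"
    and hC: "has_kl_minor k l (E - {v}) (contract_rank {v} \<rho>)" by auto
  interpret rank_function E \<rho> by fact
  interpret D: rank_function "E - {v}" \<rho> by (rule restrict) auto
  interpret C: rank_function "E - {v}" "contract_rank {v} \<rho>" using v by (intro contract) auto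
  obtain i j where ij: "i \<ge> k" "j \<ge> l" "rank_coeff (E - {v}) \<rho> i j \<noteq> 0"
    using hD D.no_kl_minor_iff_rank_coeff by blast
  obtain a b where ab: "a \<ge> k" "b \<ge> l" "rank_coeff (E - {v}) (contract_rank {v} \<rho>) a b \<noteq> 0"
    using hC C.no_kl_minor_iff_rank_coeff by blast
  from rank_function_axioms v show False
  proof (cases rule: minor_cases)
    case loop
    \<comment> \<open>A loop shifts the nonzero coefficient from \<open>(i, j)\<close> to
      \<open>(i, Suc j)\<close>, which is strictly above \<open>(k, l)\<close>.\<close>
    then show False using zero[of i "Suc j"] ij by (simp add: rank_coeff_loop[OF v])
  next
    case coloop
    then show False using zero[of "Suc i" j] ij by (simp add: rank_coeff_coloop[OF v])
  next
    case proper
    note eq = rank_coeff_proper[OF v proper]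
    have D0: "0 \<le> rank_coeff (E - {v}) \<rho> i j" for i j
      by (rule rank_coeff_nonneg) (rule D.rank_function_axioms)
    have C0: "0 \<le> rank_coeff (E - {v}) (contract_rank {v} \<rho>) i j" for i j
      by (rule rank_coeff_nonneg) (rule C.rank_function_axioms)
    \<comment> \<open>Without cancellation, both nonzero coefficients can only sit at
      \<open>(k, l)\<close>. Each is then a positive integer, and their sum is at least 2.\<close>
    have "(i, j) = (k, l)" using zero[of i j] ij D0[of i j] C0[of i j] eq[of i j] by fastforce
    moreover have "(a, b) = (k, l)" using zero[of a b] ab D0[of a b] C0[of a b] eq[of a b] by fastforce
    ultimately show False using ij ab kl eq[of k l] D0[of k l] C0[of k l] by auto
  qed
qed

section \<open>Isomorphism and minors expressed by ranks\<close>

lemma (in rank_function) isomorphic_free_loops_iff: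
  "isomorphic (rank_matroid E \<rho>) (direct_sum (uniform_matroid k k) (uniform_matroid 0 l)) \<longleftrightarrow>
    (\<exists>K L. E = K \<union> L \<and> K \<inter> L = {} \<and> card K = k \<and> card L = l \<and> \<rho> K = k \<and> \<rho> L = 0)"
    (is "isomorphic _ ?N \<longleftrightarrow> ?R")
proof -
  have gr: "ground ?N = Inl ` {..<k} \<union> Inr ` {..<l}"
    by (auto simp: direct_sum_def uniform_matroid_def Plus_def)
  \<comment> \<open>On \<open>k\<close> elements the bound \<open>k\<close> is no restriction, and
    the rank 0 summand contributes only the empty set; independence just means avoiding the right
    summand.\<close>
  have ind: "J \<in> indep ?N \<longleftrightarrow> J \<subseteq> Inl ` {..<k}" for J
  proof
    assume "J \<in> indep ?N"
    then obtain A B where AB: "J = A <+> B" "A \<subseteq> {..<k}" "B \<subseteq> {..<l}" "card B = 0"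
      by (auto simp: direct_sum_def uniform_matroid_def)
    have "finite B" using AB(3) by (rule finite_subset) simp
    then have "B = {}" using AB by simp
    then show "J \<subseteq> Inl ` {..<k}" using AB by (auto simp: Plus_def)
  next
    assume "J \<subseteq> Inl ` {..<k}"
    then obtain A where A: "A \<subseteq> {..<k}" "J = Inl ` A" by (auto simp: subset_image_iff)
    have "card A \<le> k" using card_mono[OF _ A(1)] by simp
    then have "A \<in> indep (uniform_matroid k k)" "{} \<in> indep (uniform_matroid 0 l)"
      using A(1) by (simp_all add: uniform_matroid_def)
    then have "A <+> {} \<in> indep ?N" by (simp add: direct_sum_def) blast
    then show "J \<in> indep ?N" using A(2) by (simp add: Plus_def)
  qed
  show ?thesis
  proof
    assume "isomorphic (rank_matroid E \<rho>) ?N"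
    then obtain f where f: "bij_betw f E (ground ?N)"
      and iso: "\<And>I. I \<subseteq> E \<Longrightarrow> \<rho> I = card I \<longleftrightarrow> f ` I \<subseteq> Inl ` {..<k}"
      by (auto simp: isomorphic_def indep_rank_matroid ind)
    have inj: "inj_on f E" and im: "f ` E = Inl ` {..<k} \<union> Inr ` {..<l}"
      using f gr by (auto simp: bij_betw_def)
    define K where "K = {x \<in> E. f x \<in> Inl ` {..<k}}"
    define L where "L = {x \<in> E. f x \<in> Inr ` {..<l}}"
    have KL: "E = K \<union> L" "K \<inter> L = {}" using im by (auto simp: K_def L_def)
    have "f ` K = f ` E \<inter> Inl ` {..<k}" "f ` L = f ` E \<inter> Inr ` {..<l}"
      by (auto simp: K_def L_def)
    then have fK: "f ` K = Inl ` {..<k}" and fL: "f ` L = Inr ` {..<l}"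
      unfolding im by auto
    have "card K = card (f ` K)" "card L = card (f ` L)"
      using inj by (auto simp: card_image K_def L_def inj_on_def)
    then have card: "card K = k" "card L = l" by (simp_all add: fK fL card_image)
    have "\<rho> K = k" using iso[of K] fK card KL by auto
    moreover have "\<rho> L = 0"
    proof -
      \<comment> \<open>An independent subset of \<open>L\<close> attaining its rank is mapped into
        the left summand by independence and into the right one by the choice of \<open>L\<close>,
        hence is empty.\<close>
      obtain I where I: "I \<subseteq> L" "\<rho> I = card I" "\<rho> I = \<rho> L"
        using extend_indep[of "{}" L] KL by auto
      have "f ` I \<subseteq> Inl ` {..<k}" using iso[of I] I KL by auto
      moreover have "f ` I \<subseteq> Inr ` {..<l}" using I fL by auto
      ultimately have "I = {}" by fastforce
      then show ?thesis using I by simp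
    qed
    ultimately show ?R using KL card by blast
  next
    assume ?R
    then obtain K L where KL: "E = K \<union> L" "K \<inter> L = {}" "card K = k" "card L = l" "\<rho> K = k" "\<rho> L = 0"
      by blast
    have fin': "finite K" "finite L" using KL fin by auto
    obtain g :: "'a \<Rightarrow> nat" where g: "bij_betw g K {..<k}"
      using finite_same_card_bij[of K "{..<k}"] KL fin' by auto
    obtain h :: "'a \<Rightarrow> nat" where h: "bij_betw h L {..<l}"
      using finite_same_card_bij[of L "{..<l}"] KL fin' by auto
    define f :: "'a \<Rightarrow> nat + nat" where "f = (\<lambda>x. if x \<in> K then Inl (g x) else Inr (h x))"
    have fK: "f ` K = Inl ` {..<k}" using g by (auto simp: f_def bij_betw_def)
    have "f ` L = (\<lambda>x. Inr (h x)) ` L" using KL by (intro image_cong) (auto simp: f_def)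
    then have fL: "f ` L = Inr ` {..<l}" using h by (auto simp: bij_betw_def)
    have "inj_on f E" using g h KL by (auto simp: f_def bij_betw_def inj_on_def)
    then have "bij_betw f E (ground ?N)" using fK fL KL gr by (auto simp: bij_betw_def image_Un)
    moreover have "\<rho> I = card I \<longleftrightarrow> f ` I \<subseteq> Inl ` {..<k}" if I: "I \<subseteq> E" for I
    proof
      assume "\<rho> I = card I"
      then have "\<rho> (I \<inter> L) = card (I \<inter> L)" using indep_subset_rank[of I "I \<inter> L"] I by auto
      moreover have "\<rho> (I \<inter> L) \<le> \<rho> L" using KL by (intro rank_mono) auto
      moreover have "finite (I \<inter> L)" using fin' by auto
      ultimately have "I \<inter> L = {}" using KL by simp
      then have "I \<subseteq> K" using I KL by auto
      then show "f ` I \<subseteq> Inl ` {..<k}" using fK by auto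
    next
      assume "f ` I \<subseteq> Inl ` {..<k}"
      then have "I \<subseteq> K" by (auto simp: f_def split: if_splits)
      then show "\<rho> I = card I" using indep_subset_rank[of K I] KL by auto
    qed
    ultimately show "isomorphic (rank_matroid E \<rho>) ?N"
      unfolding isomorphic_def by (intro exI[of _ f]) (auto simp: indep_rank_matroid ind)
  qed
qed

text \<open>Once \<open>X\<close>, \<open>K\<close> and \<open>L\<close> are chosen, the set to
  delete is forced to be everything else, which is why \<open>has_kl_minor\<close> does not mention
  it.\<close>

lemma (in rank_function) kl_uniform_rank_matroid:
  "kl_uniform k l (rank_matroid E \<rho>) \<longleftrightarrow> \<not> has_kl_minor k l E \<rho>"
proof -
  let ?N = "direct_sum (uniform_matroid k k) (uniform_matroid 0 l)"
  have minor: "isomorphic (delete (Defs.contract (rank_matroid E \<rho>) X) Y) ?N \<longleftrightarrow>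
      (\<exists>K L. E - X - Y = K \<union> L \<and> K \<inter> L = {} \<and> card K = k \<and> card L = l \<and>
        \<rho> (X \<union> K) = \<rho> X + k \<and> \<rho> (X \<union> L) = \<rho> X)" if X: "X \<subseteq> E" for X Y
  proof -
    interpret C: rank_function "E - X" "contract_rank X \<rho>" by (rule contract) fact
    interpret CD: rank_function "E - X - Y" "contract_rank X \<rho>" by (rule C.restrict) auto
    have rank: "contract_rank X \<rho> K = k \<longleftrightarrow> \<rho> (X \<union> K) = \<rho> X + k" if "K \<subseteq> E" for K k
    proof -
      have "\<rho> X \<le> \<rho> (X \<union> K)" using X that by (intro rank_mono) auto
      then show ?thesis by (auto simp: contract_rank_def Un_commute)
    qed
    have "contract_rank X \<rho> K = k \<and> contract_rank X \<rho> L = 0 \<longleftrightarrow>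
        \<rho> (X \<union> K) = \<rho> X + k \<and> \<rho> (X \<union> L) = \<rho> X" if "E - X - Y = K \<union> L" for K L
    proof -
      have "K \<subseteq> E" "L \<subseteq> E" using that by auto
      then show ?thesis
        using rank[of K k] rank[of L 0] by simp
    qed
    then have "(E - X - Y = K \<union> L \<and> K \<inter> L = {} \<and> card K = k \<and> card L = l \<and>
        contract_rank X \<rho> K = k \<and> contract_rank X \<rho> L = 0) \<longleftrightarrow>
        (E - X - Y = K \<union> L \<and> K \<inter> L = {} \<and> card K = k \<and> card L = l \<and>
        \<rho> (X \<union> K) = \<rho> X + k \<and> \<rho> (X \<union> L) = \<rho> X)" for K L
      by (cases "E - X - Y = K \<union> L") simp_all
    then show ?thesis
      unfolding contract_rank_matroid[OF X] C.delete_rank_matroid CD.isomorphic_free_loops_iff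
      by presburger
  qed
  have "(\<exists>N. is_minor N (rank_matroid E \<rho>) \<and> isomorphic N ?N) \<longleftrightarrow>
      (\<exists>X Y. X \<subseteq> E \<and> Y \<subseteq> E \<and> X \<inter> Y = {} \<and>
        isomorphic (delete (Defs.contract (rank_matroid E \<rho>) X) Y) ?N)"
    unfolding is_minor_def by auto
  also have "\<dots> \<longleftrightarrow> has_kl_minor k l E \<rho>"
  proof
    assume "\<exists>X Y. X \<subseteq> E \<and> Y \<subseteq> E \<and> X \<inter> Y = {} \<and>
        isomorphic (delete (Defs.contract (rank_matroid E \<rho>) X) Y) ?N"
    then obtain X Y where X: "X \<subseteq> E"
      and iso: "isomorphic (delete (Defs.contract (rank_matroid E \<rho>) X) Y) ?N"
      by blast
    from iffD1[OF minor[OF X] iso] obtain K L where "E - X - Y = K \<union> L" "K \<inter> L = {}" "card K = k" "card L = l"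
      "\<rho> (X \<union> K) = \<rho> X + k" "\<rho> (X \<union> L) = \<rho> X"
      by (elim exE conjE) (rule that)
    with X show "has_kl_minor k l E \<rho>" by (intro has_kl_minorI[of X E K L]) auto
  next
    assume "has_kl_minor k l E \<rho>"
    then show "\<exists>X Y. X \<subseteq> E \<and> Y \<subseteq> E \<and> X \<inter> Y = {} \<and>
        isomorphic (delete (Defs.contract (rank_matroid E \<rho>) X) Y) ?N"
    proof (rule has_kl_minorE)
      fix X K L
      assume XKL: "X \<subseteq> E" "K \<subseteq> E" "L \<subseteq> E" "X \<inter> K = {}" "X \<inter> L = {}" "K \<inter> L = {}"
        "card K = k" "card L = l" "\<rho> (X \<union> K) = \<rho> X + k" "\<rho> (X \<union> L) = \<rho> X"
      then have eq: "E - X - (E - X - K - L) = K \<union> L" by auto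
      have "isomorphic (delete (Defs.contract (rank_matroid E \<rho>) X) (E - X - K - L)) ?N"
        by (intro iffD2[OF minor[OF XKL(1)]] exI[of _ K] exI[of _ L] conjI) (rule eq XKL)+
      then show ?thesis using XKL by (intro exI[of _ X] exI[of _ "E - X - K - L"]) auto
    qed
  qed
  finally show ?thesis by (simp add: kl_uniform_def)
qed

lemma (in rank_function) almost_kl_uniform_rank_matroid:
  "almost_kl_uniform k l (rank_matroid E \<rho>) \<longleftrightarrow> almost_no_kl_minor k l E \<rho>"
  unfolding almost_kl_uniform_def almost_no_kl_minor_def ground_rank_matroid
proof (rule ball_cong[OF refl])
  fix v assume v: "v \<in> E"
  interpret D: rank_function "E - {v}" \<rho> by (rule restrict) auto
  interpret C: rank_function "E - {v}" "contract_rank {v} \<rho>" using v by (intro contract) auto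
  have "Defs.contract (rank_matroid E \<rho>) {v} = rank_matroid (E - {v}) (contract_rank {v} \<rho>)"
    using v by (intro contract_rank_matroid) auto
  then show "kl_uniform k l (delete (rank_matroid E \<rho>) {v}) \<or>
      kl_uniform k l (Defs.contract (rank_matroid E \<rho>) {v}) \<longleftrightarrow>
      \<not> has_kl_minor k l (E - {v}) \<rho> \<or> \<not> has_kl_minor k l (E - {v}) (contract_rank {v} \<rho>)"
    by (simp add: delete_rank_matroid D.kl_uniform_rank_matroid C.kl_uniform_rank_matroid)
qed

section \<open>The rank function of a matroid\<close>

definition matroid_rank :: "'a matroid \<Rightarrow> 'a set \<Rightarrow> nat" where
  "matroid_rank M A = Max (card ` {I \<in> indep M. I \<subseteq> A})"

context matroid
begin

lemma finite_indep: "finite {I \<in> indep M. I \<subseteq> A}"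
  by (rule finite_subset[of _ "Pow (ground M)"]) (use indep_subset_ground finite_ground in auto)

lemma finite_of_indep: "I \<in> indep M \<Longrightarrow> finite I"
  by (rule finite_subset[OF indep_subset_ground finite_ground])

lemma card_le_matroid_rank: "I \<in> indep M \<Longrightarrow> I \<subseteq> A \<Longrightarrow> card I \<le> matroid_rank M A"
  unfolding matroid_rank_def using finite_indep[of A] by (intro Max_ge) auto

lemma matroid_rank_witness:
  obtains I where "I \<in> indep M" "I \<subseteq> A" "card I = matroid_rank M A"
proof -
  have "{I \<in> indep M. I \<subseteq> A} \<noteq> {}" using empty_indep by auto
  then have "matroid_rank M A \<in> card ` {I \<in> indep M. I \<subseteq> A}"
    unfolding matroid_rank_def using finite_indep[of A] by (intro Max_in) auto
  then show ?thesis using that by auto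
qed

text \<open>An independent set that is too small is augmented from a largest independent subset of
  \<open>A\<close>, which keeps it inside \<open>A\<close>.\<close>

lemma matroid_rank_extend:
  assumes "I \<in> indep M" "I \<subseteq> A"
  obtains J where "J \<in> indep M" "I \<subseteq> J" "J \<subseteq> A" "card J = matroid_rank M A"
proof -
  have "\<exists>J. J \<in> indep M \<and> I \<subseteq> J \<and> J \<subseteq> A \<and> card J = matroid_rank M A"
    using assms
  proof (induction "matroid_rank M A - card I" arbitrary: I rule: less_induct)
    case less
    obtain J where J: "J \<in> indep M" "J \<subseteq> A" "card J = matroid_rank M A"
      by (rule matroid_rank_witness)
    show ?case
    proof (cases "card I < card J")
      case True
      then obtain x where x: "x \<in> J - I" "insert x I \<in> indep M"
        using augmentation[OF less.prems(1) J(1)] by blast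
      have "card (insert x I) = Suc (card I)" using x finite_of_indep[OF less.prems(1)] by auto
      then have dec: "matroid_rank M A - card (insert x I) < matroid_rank M A - card I"
        using True J by auto
      have "insert x I \<subseteq> A" using x J less.prems by auto
      from less.hyps[OF dec x(2) this] obtain J' where
        "J' \<in> indep M" "insert x I \<subseteq> J'" "J' \<subseteq> A" "card J' = matroid_rank M A"
        by blast
      then show ?thesis by (intro exI[of _ J']) auto
    next
      case False
      then have "card I = matroid_rank M A"
        using J card_le_matroid_rank[OF less.prems] by auto
      then show ?thesis using less.prems by blast
    qed
  qed
  then show ?thesis using that by blast
qed

lemma rank_function_matroid_rank: "rank_function (ground M) (matroid_rank M)"
proof
  show "finite (ground M)" by (rule finite_ground)
  show "matroid_rank M A \<le> card A" if "A \<subseteq> ground M" for A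
  proof -
    obtain I where "I \<in> indep M" "I \<subseteq> A" "card I = matroid_rank M A"
      by (rule matroid_rank_witness)
    then show ?thesis using card_mono[of A I] that finite_ground finite_subset by metis
  qed
  show "matroid_rank M A \<le> matroid_rank M B" if "A \<subseteq> B" for A B
  proof -
    obtain I where "I \<in> indep M" "I \<subseteq> A" "card I = matroid_rank M A"
      by (rule matroid_rank_witness)
    then show ?thesis using card_le_matroid_rank[of I B] that by auto
  qed
  show "matroid_rank M (A \<union> B) + matroid_rank M (A \<inter> B) \<le> matroid_rank M A + matroid_rank M B" for A B
  proof -
    \<comment> \<open>A largest independent set of the intersection is extended to one of the union.
      Its traces on \<open>A\<close> and \<open>B\<close> cover it and both contain
      \<open>I\<close>, so counting them gives submodularity.\<close>
    obtain I where I: "I \<in> indep M" "I \<subseteq> A \<inter> B" "card I = matroid_rank M (A \<inter> B)"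
      by (rule matroid_rank_witness)
    then obtain J where J: "J \<in> indep M" "I \<subseteq> J" "J \<subseteq> A \<union> B" "card J = matroid_rank M (A \<union> B)"
      using matroid_rank_extend[of I "A \<union> B"] by blast
    have finJ: "finite J" using J finite_of_indep by auto
    have "card (J \<inter> A) + card (J \<inter> B) = card ((J \<inter> A) \<union> (J \<inter> B)) + card ((J \<inter> A) \<inter> (J \<inter> B))"
      using finJ by (intro card_Un_Int) auto
    moreover have "(J \<inter> A) \<union> (J \<inter> B) = J" using J by auto
    moreover have "card I \<le> card ((J \<inter> A) \<inter> (J \<inter> B))" using I J finJ by (intro card_mono) auto
    moreover have "card (J \<inter> A) \<le> matroid_rank M A" "card (J \<inter> B) \<le> matroid_rank M B"
      using J indep_subset[OF J(1)] by (auto intro!: card_le_matroid_rank)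
    ultimately show ?thesis using I J by simp
  qed
qed

text \<open>This is an equality of records, not merely an isomorphism, so all results on rank
  functions transfer to \<open>M\<close> by rewriting.\<close>

lemma matroid_eq_rank_matroid: "M = rank_matroid (ground M) (matroid_rank M)"
proof -
  have "I \<in> indep M \<longleftrightarrow> I \<subseteq> ground M \<and> matroid_rank M I = card I" for I
  proof
    assume I: "I \<in> indep M"
    then have "matroid_rank M I \<le> card I"
      using rank_function.rank_le_card[OF rank_function_matroid_rank] indep_subset_ground by blast
    then show "I \<subseteq> ground M \<and> matroid_rank M I = card I"
      using card_le_matroid_rank[OF I subset_refl] indep_subset_ground[OF I] by auto
  next
    assume I: "I \<subseteq> ground M \<and> matroid_rank M I = card I"
    obtain J where J: "J \<in> indep M" "J \<subseteq> I" "card J = matroid_rank M I"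
      by (rule matroid_rank_witness)
    have "finite I" using I finite_ground finite_subset by auto
    then have "J = I" using I J by (intro card_subset_eq) auto
    then show "I \<in> indep M" using J by simp
  qed
  then have "indep M = {I. I \<subseteq> ground M \<and> matroid_rank M I = card I}" by blast
  then show ?thesis by (simp add: rank_matroid_def)
qed

end

theorem theorem1p2:
  fixes M :: "'a matroid" and r :: "('a \<times> 'a) set" and k l :: nat
  assumes "k \<ge> 1" and "l \<ge> 1"
    and "matroid M"
    and "linear_order_on (ground M) r"
  shows "almost_kl_uniform k l M \<longleftrightarrow>
    tutte_coeff r M k l \<le> 1 \<and>
    (\<forall>i j. pair_gt (i, j) (k, l) \<longrightarrow> tutte_coeff r M i j = 0)"
proof -
  interpret matroid M by fact
  let ?E = "ground M" and ?\<rho> = "matroid_rank M"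
  interpret R: rank_function ?E ?\<rho> by (rule rank_function_matroid_rank)
  have "linear_order_among r ?E"
    using assms(4) unfolding linear_order_among_def order_on_defs by blast
  then have "tutte_poly r (rank_matroid ?E ?\<rho>) = rank_poly ?E ?\<rho>"
    by (rule tutte_poly_eq_rank_poly[OF R.rank_function_axioms])
  then have "tutte_poly r M = rank_poly ?E ?\<rho>"
    unfolding matroid_eq_rank_matroid[symmetric] .
  then have coeff: "tutte_coeff r M i j = rank_coeff ?E ?\<rho> i j" for i j
    by (simp add: tutte_coeff_def rank_coeff_def)
  have "almost_kl_uniform k l M \<longleftrightarrow> almost_no_kl_minor k l ?E ?\<rho>"
    using R.almost_kl_uniform_rank_matroid unfolding matroid_eq_rank_matroid[symmetric] .
  also have "\<dots> \<longleftrightarrow> rank_coeff ?E ?\<rho> k l \<le> 1 \<and>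
      (\<forall>i j. k \<le> i \<and> l \<le> j \<and> (i, j) \<noteq> (k, l) \<longrightarrow> rank_coeff ?E ?\<rho> i j = 0)"
    using rank_coeff_of_almost_no_kl_minor[OF R.rank_function_axioms]
      almost_no_kl_minor_of_rank_coeff[OF R.rank_function_axioms] by blast
  finally show ?thesis by (simp add: coeff pair_gt_def)
qed

end
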